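(* Let $-d<0$ be a fundamental discriminant and let $\chi$ be the real primitive character of conductor $d$ attached to $\mathbb{Q}(\sqrt{-d})$, with $L(s,\chi)=\sum_{n\ge1}\chi(n)n^{-s}$. Suppose $L(1,\chi)\geq (\log d)^{-18}$. If $-d$ has one class per genus, then $d\leq d_{66}\approx 1.9\cdot 10^{130}$.
   Context: For $g\ge 1$, $d_g$ denotes the product of the first $g$ primes. For a fundamental discriminant $-d<0$, let $\mathcal{C}(-d)$ be the ideal class group of $\mathbb{Q}(\sqrt{-d})$ and $h(-d)$ its order. Let $g$ be the number of prime (primary) discriminants dividing $-d$, equivalently the number of distinct primes dividing $d$; the reduced forms of discriminant $-d$ fall into $2^{g-1}$ genera. The discriminant $-d$ is said to have one class per genus if each genus contains exactly one class, i.e. $\mathcal{C}(-d)\cong(\mathbb{Z}/2\mathbb{Z})^{g-1}$, equivalently $h(-d)=2^{g-1}$. *)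

theory Defs
  imports "HOL-Analysis.Analysis" "HOL-Number_Theory.Number_Theory" "HOL-Computational_Algebra.Squarefree"
begin

definition fundamental_disc :: "int \<Rightarrow> bool" where
  "fundamental_disc D \<longleftrightarrow>
     (D mod 4 = 1 \<and> squarefree D) \<or>
     (\<exists>m. D = 4 * m \<and> (m mod 4 = 2 \<or> m mod 4 = 3) \<and> squarefree m)"

definition kron_prime :: "int \<Rightarrow> nat \<Rightarrow> int" where
  "kron_prime D p =
     (if p = 2 then (if even D then 0 else if D mod 8 = 1 \<or> D mod 8 = 7 then 1 else -1)
      else Legendre D (int p))"

text \<open>Kronecker symbol (D/n) for n \<ge> 1, extended completely multiplicatively;
  for a fundamental discriminant D this is the real primitive character of conductor |D|.\<close>
definition kronecker :: "int \<Rightarrow> nat \<Rightarrow> int" where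
  "kronecker D n = (\<Prod>p\<in>prime_factors n. kron_prime D p ^ multiplicity p n)"

definition L1 :: "int \<Rightarrow> real" where
  "L1 D = (\<Sum>n. real_of_int (kronecker D (Suc n)) / real (Suc n))"

definition reduced_forms :: "int \<Rightarrow> (int \<times> int \<times> int) set" where
  "reduced_forms D = {(a, b, c). b^2 - 4*a*c = D \<and> 0 < a \<and> \<bar>b\<bar> \<le> a \<and> a \<le> c \<and>
       ((\<bar>b\<bar> = a \<or> a = c) \<longrightarrow> 0 \<le> b) \<and> gcd a (gcd b c) = 1}"

definition class_number :: "int \<Rightarrow> nat" where
  "class_number D = card (reduced_forms D)"

definition primorial_first :: "nat \<Rightarrow> nat" where
  "primorial_first g = \<Prod>{p. prime p \<and> card {q. prime q \<and> q < p} < g}"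

definition one_class_per_genus :: "nat \<Rightarrow> bool" where
  "one_class_per_genus d \<longleftrightarrow> class_number (- int d) = 2 ^ (card (prime_factors d) - 1)"

end

theory Submission
  imports Defs
begin

text \<open>
  The class number formula is only needed as the inequality \<open>L(1, \<chi>) \<le> 4 h / sqrt d\<close>, with 4 in place
  of \<open>\<pi>\<close>. The number \<open>\<Sum>k | k dvd n. \<chi> k\<close> of ideals of norm \<open>n\<close> is at most the number of
  representations of \<open>n\<close> by reduced forms, up to sign: an ideal gives a form with leading coefficient
  \<open>n\<close> (up to a square), and reduction theory transports it to a reduced form. Summing over \<open>n \<le> N\<close>, the
  left-hand side is \<open>N * L(1, \<chi>) + o(N)\<close> because the partial sums of \<open>\<chi>\<close> are bounded (quadratic
  reciprocity), while counting lattice points in boxes around half ellipses bounds the right-hand side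
  by \<open>4 h N / sqrt d + O(sqrt N)\<close>. With \<open>h = 2 ^ (g - 1)\<close> the hypothesis on \<open>L(1, \<chi>)\<close> becomes
  \<open>sqrt d \<le> 4 * 2 ^ (g - 1) * (ln d) ^ 18\<close>, which fails for \<open>d\<close> above the product of the first 66
  primes, since a number with \<open>g\<close> prime factors exceeds it by a factor of at least \<open>317 ^ (g - 66)\<close>.
\<close>

section \<open>The Kronecker symbol as a periodic character\<close>

text \<open>\<open>kronecker\<close> is defined from the prime factorization of its argument, so its
  periodicity, and with it the convergence of the series in \<open>L1\<close>, is invisible in the
  definition. Reciprocity turns it into a function of the residue modulo \<open>8 * k\<close>, where
  \<open>k\<close> is the odd part of \<open>d\<close>. The remaining estimates are one-sided: an
  upper bound for L(1) follows from injections alone, of ideals into representations and of products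
  of ideal data into ideal data. The constant 4 arises from enclosing a half ellipse of area \<pi> N
  / sqrt d in a box of area 4 N / sqrt d. The loss is affordable: it moves the critical size of
  \<open>d\<close> by the factor (4/\<pi>)^2 < 1.7, and even with 4 in place of \<pi> the decisive
  inequality at the product of the first 66 primes holds with a factor of more than 3 to
  spare.\<close>

lemma Legendre_values: "Legendre a p \<in> {-1, 0, 1}"
  by (auto simp: Legendre_def)

lemma Legendre_cong:
  assumes "[a = b] (mod p)" shows "Legendre a p = Legendre b p"
proof -
  have "[x = a] (mod p) \<longleftrightarrow> [x = b] (mod p)" "[a = x] (mod p) \<longleftrightarrow> [b = x] (mod p)" for x
    using assms by (auto simp: cong_def)
  then show ?thesis by (simp add: Legendre_def QuadRes_def)
qed

text \<open>Two elements of {-1, 0, 1} that agree modulo \<open>p > 2\<close> are equal, so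
  congruences obtained from Euler's criterion lift to equalities of integers.\<close>

lemma Legendre_eqI:
  fixes p :: nat
  assumes p: "p > 2" and c: "[Legendre a p = x] (mod p)" and x: "x \<in> {-1, 0, 1}"
  shows "Legendre a p = x"
proof -
  have "int p dvd Legendre a p - x"
    using c by (simp add: cong_iff_dvd_diff)
  moreover have "\<bar>Legendre a p - x\<bar> < int p"
    using Legendre_values[of a p] x p by auto
  ultimately show ?thesis
    using dvd_imp_le_int[of "Legendre a p - x" "int p"] by linarith
qed

lemma Legendre_mult:
  fixes p :: nat
  assumes p: "prime p" "p > 2"
  shows "Legendre (a * b) p = Legendre a p * Legendre b p"
proof (rule Legendre_eqI[OF p(2)])
  let ?k = "(p - 1) div 2"
  have "[Legendre a p * Legendre b p = a ^ ?k * b ^ ?k] (mod p)"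
    by (intro cong_mult euler_criterion p)
  moreover have "[Legendre (a * b) p = a ^ ?k * b ^ ?k] (mod p)"
    using euler_criterion[OF p, of "a * b"] by (simp add: power_mult_distrib)
  ultimately show "[Legendre (a * b) p = Legendre a p * Legendre b p] (mod p)"
    using cong_sym cong_trans by blast
  show "Legendre a p * Legendre b p \<in> {-1, 0, 1}"
    using Legendre_values[of a p] Legendre_values[of b p] by auto
qed

lemma Legendre_one: "prime (p :: nat) \<Longrightarrow> Legendre 1 p = 1"
proof -
  assume p: "prime p"
  have "\<not> int p dvd 1" using p by (metis int_dvd_int_iff not_prime_unit of_nat_1)
  moreover have "QuadRes (int p) 1" unfolding QuadRes_def by (rule exI[of _ 1]) simp
  ultimately show ?thesis by (simp add: Legendre_def cong_0_iff)
qed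

lemma Legendre_square:
  fixes p :: nat
  assumes "prime p" "p > 2" "\<not> int p dvd a"
  shows "Legendre a p * Legendre a p = 1"
  using assms Legendre_values[of a p] by (auto simp: Legendre_def cong_0_iff)

definition sgn4 :: "nat \<Rightarrow> int" where
  "sgn4 n = (if n mod 4 = 1 then 1 else -1)"

definition sgn8 :: "nat \<Rightarrow> int" where
  "sgn8 n = (if n mod 8 = 1 \<or> n mod 8 = 7 then 1 else -1)"

lemma odd_mod8_cases:
  fixes n :: nat
  assumes "odd n"
  shows "n mod 8 = 1 \<or> n mod 8 = 3 \<or> n mod 8 = 5 \<or> n mod 8 = 7"
  using assms by presburger

lemma mod4_mod8: "(n::nat) mod 4 = n mod 8 mod 4"
  by (simp add: mod_mod_cancel)

lemma sgn4_mult: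
  assumes "odd m" "odd n"
  shows "sgn4 (m * n) = sgn4 m * sgn4 n"
  using odd_mod8_cases[OF assms(1)] odd_mod8_cases[OF assms(2)]
  unfolding sgn4_def mod4_mod8[of "m * n"] mod4_mod8[of m] mod4_mod8[of n]
    mod_mult_eq[of m 8 n, symmetric]
  by (elim disjE) simp_all

lemma sgn8_mult:
  assumes "odd m" "odd n"
  shows "sgn8 (m * n) = sgn8 m * sgn8 n"
  using odd_mod8_cases[OF assms(1)] odd_mod8_cases[OF assms(2)]
  unfolding sgn8_def mod_mult_eq[of m 8 n, symmetric]
  by (elim disjE) simp_all

lemma minus_one_power_half:
  assumes "odd p" shows "(-1::int) ^ ((p - 1) div 2) = sgn4 p"
proof -
  have "even ((p - 1) div 2) \<longleftrightarrow> p mod 4 = 1"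
    using assms by presburger
  then show ?thesis by (simp add: sgn4_def)
qed

lemma Legendre_minus_one:
  fixes p :: nat
  assumes p: "prime p" "p > 2"
  shows "Legendre (-1) p = sgn4 p"
proof (rule Legendre_eqI[OF p(2)])
  have "odd p" using p prime_odd_nat by blast
  then show "[Legendre (-1) p = sgn4 p] (mod p)"
    using euler_criterion[OF p, of "-1"] minus_one_power_half by simp
qed (simp add: sgn4_def)

lemma Legendre_two:
  fixes p :: nat
  assumes p: "prime p" "p > 2"
  shows "Legendre 2 p = sgn8 p"
proof -
  have odd: "odd p" using p prime_odd_nat by blast
  have "\<not> int p dvd 2" using p(2) zdvd_imp_le[of "int p" 2] by auto
  then interpret GAUSS p 2
    using p by unfold_locales (auto simp: cong_0_iff)
  define h where "h = (int p - 1) div 2"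
  have hp: "int p = 2 * h + 1" using odd by (auto simp: h_def)
  \<comment> \<open>Gauss's lemma counts the numbers \<open>2 * x\<close> with
    \<open>x \<le> h\<close> that exceed \<open>h\<close>. Doubling never reaches \<open>p\<close>,
    so no reduction modulo \<open>p\<close> takes place.\<close>
  have "E = (\<lambda>x. 2 * x) ` {h div 2<..h}"
  proof -
    have *: "x * 2 mod int p = 2 * x" if "0 < x" "x \<le> h" for x
      using that hp by (simp add: mod_pos_pos_trivial)
    have "C = (\<lambda>x. 2 * x) ` {0<..h}"
      unfolding C_def B_def A_def h_def[symmetric] image_image
      by (rule image_cong) (auto simp: *)
    moreover have "x > h div 2 \<longleftrightarrow> 2 * x > h" for x
      by presburger
    moreover have "h \<ge> 0" using hp p by linarith
    ultimately show ?thesis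
      unfolding E_def h_def[symmetric] by (auto simp: image_iff)
  qed
  then have "card E = card {h div 2<..h}"
    by (simp add: card_image inj_on_def)
  then have cE: "card E = nat (h - h div 2)" by simp
  have "Legendre 2 p = (-1) ^ nat (h - h div 2)"
    using gauss_lemma cE by simp
  moreover have "even (nat (h - h div 2)) \<longleftrightarrow> p mod 8 = 1 \<or> p mod 8 = 7"
  proof -
    have "h - h div 2 \<ge> 0" using hp p by linarith
    then have "even (nat (h - h div 2)) \<longleftrightarrow> even (h - h div 2)"
      by (simp add: even_nat_iff)
    also have "\<dots> \<longleftrightarrow> int p mod 8 = 1 \<or> int p mod 8 = 7"
      using hp by presburger
    also have "\<dots> \<longleftrightarrow> p mod 8 = 1 \<or> p mod 8 = 7"
      using zmod_int[of p 8] by auto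
    finally show ?thesis .
  qed
  ultimately show ?thesis by (simp add: sgn8_def)
qed

text \<open>The usual sign is split by \<open>p mod 4\<close> so that, for fixed \<open>q\<close>,
  it is multiplicative in \<open>p\<close>: its product over the primes dividing \<open>k\<close>
  then depends only on \<open>k mod 4\<close>. The case \<open>p = q\<close> is included because
  both symbols vanish.\<close>

lemma Legendre_reciprocity:
  fixes p q :: nat
  assumes p: "prime p" "p > 2" and q: "prime q" "q > 2"
  shows "Legendre p q = (if p mod 4 = 1 then 1 else sgn4 q) * Legendre q p"
proof (cases "p = q")
  case True
  then show ?thesis by (simp add: Legendre_def cong_0_iff)
next
  case False
  have odd: "odd p" "odd q" using p q prime_odd_nat by blast+
  have "\<not> int p dvd int q" using False p q primes_dvd_imp_eq by (auto simp: int_dvd_int_iff)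
  then have sq': "Legendre q p * Legendre q p = 1" by (rule Legendre_square[OF p])
  have "Legendre p q * Legendre q p = ((-1) ^ ((q - 1) div 2)) ^ ((p - 1) div 2)"
    using Quadratic_Reciprocity[OF p q False] by (simp add: power_mult [symmetric] mult.commute)
  also have "\<dots> = sgn4 q ^ ((p - 1) div 2)"
    using minus_one_power_half[OF odd(2)] by simp
  also have "\<dots> = (if p mod 4 = 1 then 1 else sgn4 q)"
  proof -
    have "even ((p - 1) div 2) \<longleftrightarrow> p mod 4 = 1" using odd(1) by presburger
    then show ?thesis by (auto simp: sgn4_def)
  qed
  finally have eq: "Legendre p q * Legendre q p = (if p mod 4 = 1 then 1 else sgn4 q)" .
  have "Legendre p q = (Legendre p q * Legendre q p) * Legendre q p"
    unfolding mult.assoc sq' by simp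
  then show ?thesis unfolding eq .
qed

text \<open>The Jacobi symbol (n/k) for odd squarefree \<open>k\<close>, hence without
  multiplicities. With the variable on top, it is visibly periodic in \<open>n\<close>.\<close>

definition jac :: "nat \<Rightarrow> nat \<Rightarrow> int" where
  "jac k n = (\<Prod>p\<in>prime_factors k. Legendre (int n) (int p))"

lemma odd_prime_factor:
  assumes "odd (k::nat)" "p \<in> prime_factors k"
  shows "prime p" "p > 2" "odd p"
proof -
  show "prime p" using assms by auto
  have "p dvd k" using assms by auto
  then show "odd p" using assms(1) by auto
  then show "p > 2" using \<open>prime p\<close> prime_ge_2_nat[of p] by (cases "p = 2") auto
qed

lemma prod_prime_factors_squarefree:
  assumes "squarefree (k::nat)" "k > 0"
  shows "\<Prod>(prime_factors k) = k"
proof -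
  have "\<Prod>(prime_factors k) = (\<Prod>p\<in>prime_factors k. p ^ multiplicity p k)"
    using assms by (intro prod.cong) (auto simp: squarefree_factorial_semiring')
  then show ?thesis using assms prime_factorization_nat[of k] by simp
qed

lemma jac_mult: "odd k \<Longrightarrow> jac k (m * n) = jac k m * jac k n"
  unfolding jac_def prod.distrib[symmetric]
  by (auto intro!: prod.cong Legendre_mult dest: odd_prime_factor)

lemma jac_values: "jac k n \<in> {-1, 0, 1}"
proof -
  have "finite A \<Longrightarrow> (\<Prod>p\<in>A. Legendre (int n) (int p)) \<in> {-1, 0, 1}" for A
  proof (induction A rule: finite_induct)
    case (insert x F)
    then show ?case using Legendre_values[of "int n" "int x"] by auto
  qed simp
  then show ?thesis by (simp add: jac_def)
qed

lemma prod_odd: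
  fixes A :: "nat set"
  shows "finite A \<Longrightarrow> (\<And>p. p \<in> A \<Longrightarrow> odd p) \<Longrightarrow> odd (\<Prod>A)"
  by (induction A rule: finite_induct) auto

lemma Legendre_prod:
  assumes q: "prime q" "q > (2::nat)" and A: "finite A"
  shows "Legendre (int (\<Prod>A)) q = (\<Prod>p\<in>A. Legendre (int p) q)"
  using A by (induction A rule: finite_induct) (auto simp: Legendre_mult q Legendre_one)

lemma prod_sgn4_switch:
  fixes A :: "nat set"
  assumes "finite A" "\<And>p. p \<in> A \<Longrightarrow> odd p" "s \<in> {-1, 1::int}"
  shows "(\<Prod>p\<in>A. if p mod 4 = 1 then 1 else s) = (if \<Prod>A mod 4 = 1 then 1 else s)"
  using assms
proof (induction A rule: finite_induct)
  case (insert x F)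
  have o: "odd x" "odd (\<Prod>F)" using insert prod_odd[of F] by auto
  have "sgn4 (x * \<Prod>F) = sgn4 x * sgn4 (\<Prod>F)" by (rule sgn4_mult[OF o])
  then show ?case using insert by (auto simp: sgn4_def split: if_splits)
qed simp

lemma Legendre_eq_jac:
  assumes k: "odd k" "squarefree k" and q: "prime q" "q > (2::nat)"
  shows "Legendre (int k) q = (if k mod 4 = 1 then 1 else sgn4 q) * jac k q"
proof -
  have k0: "k > 0" using k(1) by (cases k) auto
  let ?A = "prime_factors k"
  have "Legendre (int k) q = (\<Prod>p\<in>?A. Legendre (int p) q)"
    using Legendre_prod[OF q, of ?A] prod_prime_factors_squarefree[OF k(2) k0] by simp
  also have "\<dots> = (\<Prod>p\<in>?A. (if p mod 4 = 1 then 1 else sgn4 q) * Legendre q p)"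
    by (rule prod.cong[OF refl], rule Legendre_reciprocity) (use odd_prime_factor[OF k(1)] q in blast)+
  also have "\<dots> = (if \<Prod>?A mod 4 = 1 then 1 else sgn4 q) * jac k q"
    unfolding prod.distrib jac_def using odd_prime_factor(3)[OF k(1)]
    by (subst prod_sgn4_switch) (simp, blast, auto simp: sgn4_def)
  finally show ?thesis using prod_prime_factors_squarefree[OF k(2) k0] by simp
qed

lemma jac_two:
  assumes k: "odd k" "squarefree k"
  shows "jac k 2 = sgn8 k"
proof -
  have k0: "k > 0" using k(1) by (cases k) auto
  have "jac k 2 = (\<Prod>p\<in>prime_factors k. sgn8 p)"
    unfolding jac_def of_nat_numeral using k(1)
    by (auto intro!: prod.cong Legendre_two dest: odd_prime_factor)
  also have "\<dots> = sgn8 (\<Prod>(prime_factors k))"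
  proof -
    have "finite A \<Longrightarrow> (\<And>p. p \<in> A \<Longrightarrow> odd p) \<Longrightarrow> (\<Prod>p\<in>A. sgn8 p) = sgn8 (\<Prod>A)" for A
      by (induction A rule: finite_induct) (auto simp: sgn8_mult prod_odd, auto simp: sgn8_def)
    from this[of "prime_factors k"] show ?thesis
      using odd_prime_factor(3)[OF k(1)] by blast
  qed
  finally show ?thesis using prod_prime_factors_squarefree[OF k(2) k0] by simp
qed

text \<open>The Kronecker symbol of an even discriminant is a product of Legendre symbols and of a
  character modulo 8, which absorbs the signs of the reciprocity law.\<close>

definition mod8_char :: "(nat \<Rightarrow> int) \<Rightarrow> bool" where
  "mod8_char e \<longleftrightarrow> (\<forall>m n. e (m * n) = e m * e n) \<and> e 1 = 1 \<and>
     (\<forall>n. e (n mod 8) = e n) \<and> (\<forall>n. e n \<in> {-1, 0, 1})"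

lemma sgn_mod8: "sgn4 (n mod 8) = sgn4 n" "sgn8 (n mod 8) = sgn8 n"
  by (simp_all add: sgn4_def sgn8_def mod_mod_cancel)

lemma even_mod8: "even (n mod 8) \<longleftrightarrow> even (n::nat)"
  by (simp add: dvd_mod_iff)

lemma mod8_char_sgn4: "mod8_char (\<lambda>n. if even n then 0 else sgn4 n)"
  unfolding mod8_char_def by (auto simp: sgn_mod8 even_mod8 sgn4_mult) (auto simp: sgn4_def split: if_splits)

lemma mod8_char_sgn8: "mod8_char (\<lambda>n. if even n then 0 else sgn8 n)"
  unfolding mod8_char_def by (auto simp: sgn_mod8 even_mod8 sgn8_mult) (auto simp: sgn8_def split: if_splits)

lemma mod8_char_times:
  assumes "mod8_char e" "mod8_char f" shows "mod8_char (\<lambda>n. e n * f n)"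
proof -
  have "e n * f n \<in> {-1, 0, 1}" for n
  proof -
    have "e n \<in> {-1, 0, 1}" "f n \<in> {-1, 0, 1}"
      using assms unfolding mod8_char_def by blast+
    then show ?thesis by auto
  qed
  then show ?thesis using assms unfolding mod8_char_def by simp
qed

lemma mod8_char_one: "mod8_char (\<lambda>n. 1)"
  unfolding mod8_char_def by simp

lemma squarefree_nat_if_int: "squarefree (int n) \<Longrightarrow> squarefree n"
proof (rule squarefreeI)
  fix x assume "squarefree (int n)" "x\<^sup>2 dvd n"
  then have "int x dvd 1" using squarefreeD[of "int n" "int x"]
    by (metis int_dvd_int_iff of_nat_power)
  then show "x dvd 1" by (metis int_dvd_int_iff of_nat_1)
qed

lemma Legendre_minus_four_mult:
  fixes q :: nat
  assumes q: "prime q" "q > 2"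
  shows "Legendre (- (4 * a)) q = sgn4 q * Legendre a q"
proof -
  have "\<not> int q dvd 2" using q(2) zdvd_imp_le[of "int q" 2] by auto
  then have "Legendre 2 q * Legendre 2 q = 1" by (rule Legendre_square[OF q])
  moreover have "Legendre ((-1) * ((2 * 2) * a)) q
      = Legendre (-1) q * ((Legendre 2 q * Legendre 2 q) * Legendre a q)"
    unfolding Legendre_mult[OF q, of "-1"] Legendre_mult[OF q, of "2 * 2"]
      Legendre_mult[OF q, of 2] ..
  ultimately have "Legendre ((-1) * ((2 * 2) * a)) q = sgn4 q * (1 * Legendre a q)"
    by (simp only: Legendre_minus_one[OF q])
  then show ?thesis by simp
qed

text \<open>Here \<open>k\<close> is the odd part of \<open>d\<close>, which equals
  \<open>k\<close>, \<open>4 * k\<close> or \<open>8 * k\<close>, and \<open>e\<close> is the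
  component of the character at 2. For odd \<open>d\<close> the sign from -1 cancels the reciprocity
  sign because \<open>d mod 4 = 3\<close>, so \<open>e\<close> is trivial.\<close>

lemma kron_prime_eq_jac:
  assumes d: "d > 0" and fd: "fundamental_disc (- int d)"
  obtains k e where "odd k" "squarefree k" "k dvd d" "d dvd 8 * k" "mod8_char e"
    "\<And>q. prime q \<Longrightarrow> kron_prime (- int d) q = e q * jac k q"
proof -
  consider "(- int d) mod 4 = 1" "squarefree (- int d)"
    | m where "- int d = 4 * m" "m mod 4 = 2 \<or> m mod 4 = 3" "squarefree m"
    using fd unfolding fundamental_disc_def by blast
  then show ?thesis
  proof cases
    case 1
    have d4: "d mod 4 = 3" "odd d" using 1(1) by presburger+
    have sf: "squarefree d"
      using 1(2) squarefree_nat_if_int by simp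
    have "kron_prime (- int d) q = 1 * jac d q" if q: "prime q" for q
    proof (cases "q = 2")
      case True
      \<comment> \<open>Negation swaps the classes 1 and 7 modulo 8, so the value at 2 is the same
        for \<open>d\<close> and \<open>- d\<close>.\<close>
      have "(- int d) mod 8 = 1 \<or> (- int d) mod 8 = 7 \<longleftrightarrow> d mod 8 = 1 \<or> d mod 8 = 7"
        by presburger
      then show ?thesis using True d4 jac_two[OF d4(2) sf]
        by (simp add: kron_prime_def sgn8_def)
    next
      case False
      then have q2: "q > 2" using prime_ge_2_nat[OF q] by simp
      have "Legendre (- int d) q = sgn4 q * Legendre (int d) q"
        using Legendre_mult[OF q q2, of "-1" "int d"] Legendre_minus_one[OF q q2] by simp
      also have "\<dots> = sgn4 q * sgn4 q * jac d q"
        using Legendre_eq_jac[OF d4(2) sf q q2] d4 by simp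
      finally show ?thesis using False by (simp add: kron_prime_def sgn4_def split: if_splits)
    qed
    with d4 sf show ?thesis
      by (intro that[of d "\<lambda>_. 1"]) (auto simp: mod8_char_one)
  next
    case (2 m)
    define n where "n = nat (- m)"
    have nm: "m = - int n" using 2(1) d by (simp add: n_def)
    have dn: "d = 4 * n" using 2(1) nm by linarith
    have sfn: "squarefree n"
      using 2(3) nm squarefree_nat_if_int by simp
    have n4: "n mod 4 = 1 \<or> n mod 4 = 2" using 2(2) nm by presburger
    have L: "Legendre (- int d) q = sgn4 q * Legendre (int n) q" if "prime q" "q > 2" for q :: nat
      using Legendre_minus_four_mult[OF that, of "int n"] dn by simp
    show ?thesis
    proof (cases "odd n")
      case True
      then have n1: "n mod 4 = 1" using n4 by presburger
      have "kron_prime (- int d) q = (if even q then 0 else sgn4 q) * jac n q" if q: "prime q" for q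
      proof (cases "q = 2")
        case True
        then show ?thesis by (simp add: kron_prime_def dn)
      next
        case False
        then have q2: "q > 2" "odd q" using prime_ge_2_nat[OF q] prime_odd_nat[OF q] by auto
        then show ?thesis using L[OF q q2(1)] Legendre_eq_jac[OF \<open>odd n\<close> sfn q q2(1)] n1 False
          by (simp add: kron_prime_def)
      qed
      with True sfn show ?thesis
        by (intro that[of n "\<lambda>q. if even q then 0 else sgn4 q"]) (auto simp: mod8_char_sgn4 dn)
    next
      case False
      then obtain k where nk: "n = 2 * k" by (auto elim: evenE)
      have ok: "odd k" using n4 nk False by presburger
      have sfk: "squarefree k" using sfn nk by (metis squarefree_mono dvd_triv_right)
      let ?e4 = "\<lambda>q::nat. if even q then 0 else sgn4 q"
      let ?e8 = "\<lambda>q::nat. if even q then 0 else sgn8 q"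
      \<comment> \<open>One \<open>sgn4\<close> comes from the factor -4 and \<open>sgn8\<close>
        from the factor 2 of \<open>n\<close>; reciprocity contributes a second \<open>sgn4\<close>
        exactly when \<open>k mod 4 = 3\<close>.\<close>
      define e where "e = (if k mod 4 = 1 then (\<lambda>q. ?e4 q * ?e8 q) else (\<lambda>q. ?e4 q * (?e4 q * ?e8 q)))"
      have e: "mod8_char e" unfolding e_def
        using mod8_char_times mod8_char_sgn4 mod8_char_sgn8 by simp
      have "kron_prime (- int d) q = e q * jac k q" if q: "prime q" for q
      proof (cases "q = 2")
        case True
        then show ?thesis by (simp add: kron_prime_def dn e_def)
      next
        case False
        then have q2: "q > 2" "odd q" using prime_ge_2_nat[OF q] prime_odd_nat[OF q] by auto
        have "Legendre (- int d) q = sgn4 q * (sgn8 q * Legendre (int k) q)"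
          using L[OF q q2(1)] Legendre_mult[OF q q2(1), of 2 "int k"] Legendre_two[OF q q2(1)] nk
          by simp
        then show ?thesis using Legendre_eq_jac[OF ok sfk q q2(1)] False q2(2)
          by (simp add: kron_prime_def e_def)
      qed
      with ok sfk e show ?thesis
        by (intro that[of k e]) (auto simp: dn nk)
    qed
  qed
qed

section \<open>Periodicity of the character and cancellation over a period\<close>

lemma kronecker_eq_multiplicative:
  assumes mult: "\<And>m n. f (m * n) = f m * (f n :: int)" and one: "f 1 = 1"
    and pr: "\<And>q. prime q \<Longrightarrow> kron_prime D q = f q" and n: "n > 0"
  shows "kronecker D n = f n"
proof -
  have pow: "f (p ^ i) = f p ^ i" for p i
    by (induction i) (use one in \<open>auto simp: mult\<close>)
  have "f (\<Prod>p\<in>A. g p) = (\<Prod>p\<in>A. f (g p))" for A and g :: "nat \<Rightarrow> nat"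
    by (induction A rule: infinite_finite_induct) (use one in \<open>auto simp: mult\<close>)
  then have "f (\<Prod>p\<in>prime_factors n. p ^ multiplicity p n) = (\<Prod>p\<in>prime_factors n. f p ^ multiplicity p n)"
    by (simp add: pow)
  also have "\<dots> = kronecker D n"
    unfolding kronecker_def using pr by (intro prod.cong) (auto dest!: in_prime_factors_imp_prime)
  finally show ?thesis using prime_factorization_nat[of n] n by simp
qed

lemma sum_lessThan_add:
  fixes f :: "nat \<Rightarrow> int"
  shows "sum f {..<a + b} = sum f {..<a} + (\<Sum>n<b. f (a + n))"
  by (induction b) auto

lemma periodic_partial_sums_bounded:
  fixes f :: "nat \<Rightarrow> int"
  assumes M: "M > 0" and per: "\<And>n. f (M + n) = f n" and z: "sum f {..<M} = 0"
    and b: "\<And>n. \<bar>f n\<bar> \<le> 1"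
  shows "\<bar>sum f {..<N}\<bar> \<le> int M"
proof (induction N rule: less_induct)
  case (less N)
  show ?case
  proof (cases "N < M")
    case True
    have "\<bar>sum f {..<N}\<bar> \<le> (\<Sum>n<N. \<bar>f n\<bar>)" by (rule sum_abs)
    also have "\<dots> \<le> (\<Sum>n<N. 1)" by (intro sum_mono b)
    finally show ?thesis using True by simp
  next
    case False
    then have "sum f {..<N} = sum f {..<N - M}"
      using sum_lessThan_add[of f M "N - M"] z per by simp
    then show ?thesis using less[of "N - M"] M False by simp
  qed
qed

text \<open>Squaring modulo \<open>p\<close> identifies 1 and \<open>p - 1\<close>, so it is not
  injective on the residues and, by finiteness, misses one of them.\<close>

lemma quadratic_nonresidue_exists:
  fixes p :: nat
  assumes p: "prime p" "p > 2"
  obtains a :: nat where "Legendre (int a) p = -1"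
proof -
  let ?f = "\<lambda>x. x\<^sup>2 mod p"
  have fin: "finite {0..<p}" by simp
  have "\<not> inj_on ?f {0..<p}"
  proof
    assume inj: "inj_on ?f {0..<p}"
    have sq: "(p - 1)\<^sup>2 mod p = 1\<^sup>2 mod p"
    proof -
      have "(p - 1)\<^sup>2 = p * (p - 2) + 1"
      proof -
        obtain q where "p = q + 2" using p by (metis add.commute le_add_diff_inverse less_imp_le)
        then show ?thesis by (simp add: power2_eq_square algebra_simps)
      qed
      then have "(p - 1)\<^sup>2 mod p = 1 mod p" by (metis mod_mult_self4)
      then show ?thesis by simp
    qed
    show False using inj_onD[OF inj sq] p by auto
  qed
  then have "?f ` {0..<p} \<noteq> {0..<p}"
    using eq_card_imp_inj_on[OF fin, of ?f] by auto
  moreover have "?f ` {0..<p} \<subseteq> {0..<p}" using p by auto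
  ultimately obtain a where a: "a < p" "a \<notin> ?f ` {0..<p}"
    by (metis atLeastLessThan_iff subsetI subset_antisym)
  have "\<not> QuadRes (int p) (int a)"
  proof
    assume "QuadRes (int p) (int a)"
    then obtain y where y: "[y\<^sup>2 = int a] (mod int p)" unfolding QuadRes_def by blast
    define x where "x = nat (y mod int p)"
    have ix: "int x = y mod int p" using p by (simp add: x_def)
    have "int (x\<^sup>2 mod p) = int a"
      using y a(1) by (simp add: ix zmod_int power_mod cong_def)
    moreover have "x < p" using ix p by (metis of_nat_less_iff pos_mod_bound of_nat_0_less_iff prime_gt_0_nat)
    ultimately show False using a(2) by (auto simp: image_iff)
  qed
  moreover have "a \<noteq> 0"
  proof
    assume "a = 0"
    then have "a = ?f 0" "0 \<in> {0..<p}" using p by auto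
    then show False using a(2) by blast
  qed
  ultimately have "Legendre (int a) p = -1"
    using a(1) nat_dvd_not_less[of a p] by (simp add: Legendre_def cong_0_iff int_dvd_int_iff)
  then show ?thesis by (rule that)
qed

text \<open>Some \<open>a\<close> coprime to the period has \<open>f a = -1\<close>. Multiplication
  by \<open>a\<close> permutes the residues, so the sum over a period equals its own negative and
  vanishes.\<close>

lemma kronecker_character:
  assumes d: "d > 8" and fd: "fundamental_disc (- int d)"
  obtains f B where "\<And>n. n > 0 \<Longrightarrow> kronecker (- int d) n = f n"
    "\<And>m n. f (m * n) = f m * f n" "f 1 = 1" "f 0 = 0" "\<And>n. f n \<in> {-1, 0, 1}"
    "\<And>N. \<bar>sum f {..<N}\<bar> \<le> int B"
proof -
  obtain k e where k: "odd k" "squarefree k" "k dvd d" "d dvd 8 * k" and e: "mod8_char e"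
    and kp: "\<And>q. prime q \<Longrightarrow> kron_prime (- int d) q = e q * jac k q"
    using kron_prime_eq_jac[OF _ fd] d by (metis gr0I not_less_zero)
  have k0: "k > 0" using k(1) by (cases k) auto
  have em: "e (m * n) = e m * e n" and e1: "e 1 = 1" and e8: "e (n mod 8) = e n"
    and ev: "e n \<in> {-1, 0, 1}" for m n
    using e unfolding mod8_char_def by blast+
  define f where "f n = e n * jac k n" for n
  \<comment> \<open>This is where \<open>d > 8\<close> enters: it guarantees an odd prime
    \<open>p\<close> dividing the conductor, at which the sign can be changed.\<close>
  have "k \<noteq> 1" using k(4) d by (auto dest: dvd_imp_le)
  then obtain p where p: "prime p" "p dvd k" using prime_factor_nat by blast
  then have pk: "p \<in> prime_factors k" using k0 by (auto simp: prime_factors_dvd)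
  have p2: "p > 2" using odd_prime_factor[OF k(1) pk] by simp
  have fm: "f (m * n) = f m * f n" for m n
    by (simp add: f_def em jac_mult k)
  have f1: "f 1 = 1"
  proof -
    have "jac k 1 = 1" unfolding jac_def of_nat_1
      by (intro prod.neutral) (auto intro!: Legendre_one)
    then show ?thesis by (simp add: f_def e1[simplified])
  qed
  have f0: "f 0 = 0"
  proof -
    have "jac k 0 = 0" unfolding jac_def by (rule prod_zero) (use pk in \<open>auto simp: Legendre_def\<close>)
    then show ?thesis by (simp add: f_def)
  qed
  have fv: "f n \<in> {-1, 0, 1}" for n
    using ev[of n] jac_values[of k n] by (auto simp: f_def)
  have fcong: "f m = f n" if mn: "[m = n] (mod (8 * k))" for m n
  proof -
    have "[m = n] (mod 8)" using mn by (metis cong_dvd_modulus_nat dvd_triv_left)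
    then have "e m = e n" using e8[of m] e8[of n] by (simp add: cong_def)
    moreover have "Legendre (int m) (int q) = Legendre (int n) (int q)" if "q \<in> prime_factors k" for q
    proof -
      have "q dvd 8 * k" using that by auto
      then have "[m = n] (mod q)" using mn cong_dvd_modulus_nat by blast
      then show ?thesis by (intro Legendre_cong) (simp add: cong_int_iff)
    qed
    then have "jac k m = jac k n" unfolding jac_def by (intro prod.cong) auto
    ultimately show ?thesis by (simp add: f_def)
  qed
  have z: "sum f {..<8 * k} = 0"
  proof -
    obtain j where kj: "k = p * j" using p by auto
    have cop: "coprime p (8 * j)"
    proof -
      have "\<not> p dvd j"
      proof
        assume "p dvd j"
        then have "p\<^sup>2 dvd k" using kj by (simp add: power2_eq_square)
        then show False using k(2) p unfolding squarefree_def by (metis not_prime_unit)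
      qed
      moreover have "\<not> p dvd 8"
      proof
        assume "p dvd 8"
        then have "p dvd 2 ^ 3" by simp
        then have "p dvd 2" using p prime_dvd_power by blast
        then show False using p2 by (auto dest: dvd_imp_le)
      qed
      ultimately show ?thesis
        using p prime_imp_coprime prime_dvd_mult_iff by blast
    qed
    obtain a0 where a0: "Legendre (int a0) p = -1"
      using quadratic_nonresidue_exists[OF p(1) p2] .
    \<comment> \<open>A nonresidue modulo \<open>p\<close> that is 1 modulo \<open>8 * j\<close>: it
      flips the factor at \<open>p\<close> and leaves all other Legendre factors and
      \<open>e\<close> equal to 1. Coprimality holds because \<open>k\<close> is odd and
      squarefree.\<close>
    obtain a where a: "[a = a0] (mod p)" "[a = 1] (mod (8 * j))"
      using binary_chinese_remainder_nat[OF cop] by blast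
    have Lp: "Legendre (int a) p = -1"
      using a0 Legendre_cong[of "int a" "int a0" "int p"] a(1) by (simp add: cong_int_iff)
    have Lq: "Legendre (int a) q = 1" if "q \<in> prime_factors k" "q \<noteq> p" for q
    proof -
      have "prime q" "q dvd p * j" using that kj by (auto simp: in_prime_factors_iff)
      then have "q dvd j" using that p primes_dvd_imp_eq by (metis prime_dvd_mult_iff)
      then have "[a = 1] (mod q)" using a(2) cong_dvd_modulus_nat by (metis dvd_mult)
      then have "Legendre (int a) q = Legendre 1 q"
        by (intro Legendre_cong) (metis cong_int_iff of_nat_1)
      then show ?thesis using that Legendre_one by auto
    qed
    have "jac k a = -1"
      unfolding jac_def by (subst prod.remove[OF _ pk]) (use Lp Lq in auto)
    moreover have "e a = 1"
    proof -
      have "[a = 1] (mod 8)" using a(2) by (metis cong_dvd_modulus_nat dvd_triv_left)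
      then have "a mod 8 = 1 mod 8" by (simp add: cong_def)
      then show ?thesis using e8[of a] e8[of 1] e1 by metis
    qed
    ultimately have fa: "f a = -1" by (simp add: f_def)
    have copa: "coprime a (8 * k)"
    proof -
      have "\<not> p dvd a"
        using Lp by (auto simp: Legendre_def cong_0_iff int_dvd_int_iff split: if_splits)
      then have "coprime a p"
        using p prime_imp_coprime coprime_commute by metis
      moreover have "coprime a (8 * j)" using a(2)

        by (metis cong_imp_coprime cong_sym coprime_1_left)
      ultimately have "coprime a (p * (8 * j))" by simp
      then show ?thesis by (simp add: kj mult.left_commute)
    qed
    have inj: "inj_on (\<lambda>n. a * n mod (8 * k)) {..<8 * k}"
    proof (rule inj_onI)
      fix x y assume xy: "x \<in> {..<8 * k}" "y \<in> {..<8 * k}" "a * x mod (8 * k) = a * y mod (8 * k)"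
      then have "[x = y] (mod (8 * k))"
        using copa cong_mult_lcancel_nat unfolding cong_def[symmetric] by blast
      then show "x = y" using xy by (simp add: cong_def)
    qed
    have sub: "(\<lambda>n. a * n mod (8 * k)) ` {..<8 * k} \<subseteq> {..<8 * k}"
      using k0 by auto
    have "bij_betw (\<lambda>n. a * n mod (8 * k)) {..<8 * k} {..<8 * k}"
      unfolding bij_betw_def using inj endo_inj_surj[OF finite_lessThan sub inj] by (rule conjI)
    then have "sum f {..<8 * k} = (\<Sum>n<8 * k. f (a * n mod (8 * k)))"
      by (rule sum.reindex_bij_betw[symmetric])
    also have "\<dots> = (\<Sum>n<8 * k. f (a * n))"
      by (intro sum.cong refl fcong) (simp add: cong_def)
    also have "\<dots> = - sum f {..<8 * k}"
      by (simp add: fm fa sum_negf)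
    finally show ?thesis by simp
  qed
  have "\<bar>sum f {..<N}\<bar> \<le> int (8 * k)" for N
  proof (rule periodic_partial_sums_bounded[OF _ _ z])
    show "f (8 * k + n) = f n" for n by (rule fcong) (simp add: cong_def)
    show "\<bar>f n\<bar> \<le> 1" for n using fv[of n] by auto
  qed (use k0 in simp)
  moreover have "kronecker (- int d) n = f n" if "n > 0" for n
    by (rule kronecker_eq_multiplicative[OF fm f1 _ that]) (simp add: kp f_def)
  ultimately show ?thesis using that[of f "8 * k"] fm f1 f0 fv by blast
qed

section \<open>Reduction of forms\<close>

text \<open>The minimal polynomial of \<open>(sqrt D - D mod 2) / 2\<close>; substituting \<open>b = 2 * t + D mod 2\<close>
  turns \<open>b\<^sup>2 \<equiv> D (mod 4 * n)\<close> into a condition modulo \<open>n\<close>.\<close>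

definition disc_poly :: "int \<Rightarrow> int \<Rightarrow> int" where
  "disc_poly D t = t\<^sup>2 + (D mod 2) * t - D div 4"

lemma disc_poly_eq:
  assumes "D mod 4 = 0 \<or> D mod 4 = 1"
  shows "(2 * t + D mod 2)\<^sup>2 - D = 4 * disc_poly D t"
proof -
  have D: "D = D mod 2 + 4 * (D div 4)" using assms by presburger
  have sq: "(D mod 2)\<^sup>2 = D mod 2"
    by (cases "even D") (auto simp: even_iff_mod_2_eq_zero odd_iff_mod_2_eq_one)
  have "(2 * t + D mod 2)\<^sup>2 = 4 * t\<^sup>2 + 4 * (D mod 2) * t + (D mod 2)\<^sup>2"
    by (simp add: power2_eq_square algebra_simps)
  then show ?thesis
    unfolding disc_poly_def sq using D by (simp add: algebra_simps)
qed

lemma fundamental_disc_mod4: "fundamental_disc D \<Longrightarrow> D mod 4 = 0 \<or> D mod 4 = 1"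
  unfolding fundamental_disc_def by auto

text \<open>A common prime \<open>p\<close> gives \<open>D = p\<^sup>2 * D'\<close> with
  \<open>D'\<close> itself of the shape of a discriminant. Squarefreeness forbids this except for
  \<open>p = 2\<close> and \<open>D = 4 * m\<close>, where \<open>m = D'\<close> would be 0 or 1
  modulo 4. Thus reduction need not carry the gcd condition along.\<close>

lemma fundamental_disc_primitive:
  assumes fd: "fundamental_disc D" and D: "b\<^sup>2 - 4 * a * c = D"
  shows "gcd a (gcd b c) = 1"
proof (rule ccontr)
  assume "gcd a (gcd b c) \<noteq> 1"
  then have "\<not> is_unit (gcd a (gcd b c))"
    by (metis abs_1 abs_gcd_int zdvd1_eq)
  moreover have "gcd a (gcd b c) \<noteq> 0"
  proof
    assume "gcd a (gcd b c) = 0"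
    then have "D = 0" using D by simp
    then show False using fd by (auto simp: fundamental_disc_def)
  qed
  ultimately obtain p where p: "prime p" "p dvd gcd a (gcd b c)"
    using prime_divisor_exists by blast
  then obtain a' b' c' where abc: "a = p * a'" "b = p * b'" "c = p * c'"
    by (meson dvd_def dvd_gcdD1 dvd_gcdD2 dvd_trans)
  have Dp: "D = p\<^sup>2 * (b'\<^sup>2 - 4 * a' * c')"
    using D abc by (simp add: power2_eq_square algebra_simps)
  have nu: "\<not> is_unit p" using p(1) not_prime_unit by blast
  from fd consider "D mod 4 = 1" "squarefree D"
    | m where "D = 4 * m" "m mod 4 = 2 \<or> m mod 4 = 3" "squarefree m"
    unfolding fundamental_disc_def by blast
  then show False
  proof cases
    case 1
    then show False using Dp nu squarefreeD[of D p] by simp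
  next
    case (2 m)
    show False
    proof (cases "p = 2")
      case True
      then have m: "m = b'\<^sup>2 - 4 * (a' * c')" using Dp 2(1) by simp
      have "b'\<^sup>2 mod 4 = 0 \<or> b'\<^sup>2 mod 4 = 1"
      proof (cases "even b'")
        case True
        then obtain z where "b' = 2 * z" by (auto elim: evenE)
        then show ?thesis by (simp add: power2_eq_square)
      next
        case False
        then obtain z where "b' = 2 * z + 1" by (auto elim: oddE)
        then have "b'\<^sup>2 = 4 * (z\<^sup>2 + z) + 1" by (simp add: power2_eq_square algebra_simps)
        then show ?thesis by presburger
      qed
      then show False using 2(2) m by presburger
    next
      case False
      have "coprime (p\<^sup>2) 4"
      proof -
        have "coprime p 2" by (rule primes_coprime[OF p(1) _ False]) simp
        then have "coprime (p\<^sup>2) (2\<^sup>2)"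
          by (simp only: power2_eq_square coprime_mult_left_iff coprime_mult_right_iff)
        then show ?thesis by simp
      qed
      moreover have "p\<^sup>2 dvd 4 * m" using Dp 2(1) by simp
      ultimately have "p\<^sup>2 dvd m" by (simp add: coprime_dvd_mult_right_iff)
      then show False using 2(3) nu squarefreeD by blast
    qed
  qed
qed

lemma reduced_formsI:
  assumes "fundamental_disc D" "b\<^sup>2 - 4 * a * c = D" "0 < a" "\<bar>b\<bar> \<le> a" "a \<le> c"
    "\<bar>b\<bar> = a \<or> a = c \<Longrightarrow> 0 \<le> b"
  shows "(a, b, c) \<in> reduced_forms D"
  using assms fundamental_disc_primitive[OF assms(1,2)] unfolding reduced_forms_def by blast

definition form_val :: "int \<times> int \<times> int \<Rightarrow> int \<Rightarrow> int \<Rightarrow> int" where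
  "form_val f x y = (case f of (a, b, c) \<Rightarrow> a * x\<^sup>2 + b * x * y + c * y\<^sup>2)"

text \<open>Twice the symmetric bilinear form of \<open>f\<close>, which is the middle coefficient
  after substituting by the matrix with columns \<open>(x, y)\<close> and
  \<open>(u, v)\<close>.\<close>

definition form_polar :: "int \<times> int \<times> int \<Rightarrow> int \<Rightarrow> int \<Rightarrow> int \<Rightarrow> int \<Rightarrow> int" where
  "form_polar f x y u v =
     (case f of (a, b, c) \<Rightarrow> 2 * a * x * u + b * (x * v + y * u) + 2 * c * y * v)"

text \<open>Proper equivalence, with the matrix acting on the reduced form: its first column is then
  the vector at which the reduced form takes the value \<open>a\<close>.\<close>

definition equiv_reduced :: "int \<Rightarrow> int \<times> int \<times> int \<Rightarrow> bool" where
  "equiv_reduced D g = (case g of (a, b, c) \<Rightarrow> \<exists>f\<in>reduced_forms D. \<exists>x y u v. x * v - y * u = 1 \<and>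
     form_val f x y = a \<and> form_polar f x y u v = b \<and> form_val f u v = c)"

lemma equiv_reduced_translate:
  assumes "equiv_reduced D (a, b, c)"
  shows "equiv_reduced D (a, b + 2 * q * a, c + q * b + q\<^sup>2 * a)"
proof -
  obtain a' b' c' x y u v where f: "(a', b', c') \<in> reduced_forms D" "x * v - y * u = 1"
    "form_val (a', b', c') x y = a" "form_polar (a', b', c') x y u v = b" "form_val (a', b', c') u v = c"
    using assms unfolding equiv_reduced_def by auto
  have "x * (v + q * y) - y * (u + q * x) = 1" using f(2) by (simp add: algebra_simps)
  moreover have "form_polar (a', b', c') x y (u + q * x) (v + q * y) = b + 2 * q * a"
    unfolding f(3)[symmetric] f(4)[symmetric] form_polar_def form_val_def
    by (simp add: power2_eq_square algebra_simps)
  moreover have "form_val (a', b', c') (u + q * x) (v + q * y) = c + q * b + q\<^sup>2 * a"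
    unfolding f(3)[symmetric] f(4)[symmetric] f(5)[symmetric] form_polar_def form_val_def
    by (simp add: power2_eq_square algebra_simps)
  ultimately show ?thesis unfolding equiv_reduced_def using f(1,3) by blast
qed

lemma equiv_reduced_swap:
  assumes "equiv_reduced D (c, - b, a)"
  shows "equiv_reduced D (a, b, c)"
proof -
  obtain a' b' c' x y u v where f: "(a', b', c') \<in> reduced_forms D" "x * v - y * u = 1"
    "form_val (a', b', c') x y = c" "form_polar (a', b', c') x y u v = - b" "form_val (a', b', c') u v = a"
    using assms unfolding equiv_reduced_def by auto
  have "u * (- y) - v * (- x) = 1" using f(2) by (simp add: algebra_simps)
  moreover have "form_polar (a', b', c') u v (- x) (- y) = b"
    using f(4) unfolding form_polar_def by (simp add: algebra_simps)
  moreover have "form_val (a', b', c') (- x) (- y) = c"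
    using f(3) unfolding form_val_def by simp
  ultimately show ?thesis unfolding equiv_reduced_def using f(1,5) by blast
qed

lemma equiv_reduced_self:
  assumes "(a, b, c) \<in> reduced_forms D"
  shows "equiv_reduced D (a, b, c)"
proof -
  have "(1::int) * 1 - 0 * 0 = 1" "form_val (a, b, c) 1 0 = a" "form_polar (a, b, c) 1 0 0 1 = b"
    "form_val (a, b, c) 0 1 = c"
    by (simp_all add: form_val_def form_polar_def)
  then show ?thesis using assms unfolding equiv_reduced_def by blast
qed

text \<open>Gauss reduction, by induction on the leading coefficient: a translation makes the middle
  coefficient small, and if the last coefficient is then below \<open>a\<close>, a swap makes it the
  leading one.\<close>

lemma every_form_equiv_reduced:
  assumes fd: "fundamental_disc D" and D: "D < 0" and a: "a > 0" and disc: "b\<^sup>2 - 4 * a * c = D"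
  shows "equiv_reduced D (a, b, c)"
  using a disc
proof (induction "nat a" arbitrary: a b c rule: less_induct)
  case (less a b c)
  \<comment> \<open>The shift by \<open>a - 1\<close> places \<open>b1\<close> in the interval from
    \<open>- a\<close> (excluded) to \<open>a\<close> (included), so that
    \<open>\<bar>b1\<bar> = a\<close> forces \<open>b1 = a\<close>, as a reduced form
    demands.\<close>
  define q where "q = (b + a - 1) div (2 * a)"
  define b1 where "b1 = b - 2 * q * a"
  define c1 where "c1 = c - q * b + q\<^sup>2 * a"
  have "b1 = (b + a - 1) mod (2 * a) - a + 1"
    unfolding b1_def q_def by (simp add: minus_mult_div_eq_mod[symmetric] algebra_simps)
  moreover have "(b + a - 1) mod (2 * a) \<ge> 0" "(b + a - 1) mod (2 * a) < 2 * a"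
    using less.prems(1) by auto
  ultimately have b1: "- a < b1" "b1 \<le> a" by linarith+
  have disc1: "b1\<^sup>2 - 4 * a * c1 = D"
    using less.prems(2) unfolding b1_def c1_def by (simp add: power2_eq_square algebra_simps)
  have c1: "c1 > 0"
  proof -
    have "4 * a * c1 > 0" using disc1 D zero_le_power2[of b1] by linarith
    then show ?thesis using less.prems(1) by (simp add: zero_less_mult_iff)
  qed
  have "equiv_reduced D (a, b1, c1)"
  proof (cases "c1 < a")
    case True
    have "equiv_reduced D (c1, - b1, a)"
    proof (rule less.hyps)
      show "nat c1 < nat a" using True c1 by simp
      show "(- b1)\<^sup>2 - 4 * c1 * a = D" using disc1 by (simp add: algebra_simps)
    qed (rule c1)
    then show ?thesis by (rule equiv_reduced_swap)
  next
    case False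
    show ?thesis
    proof (cases "a = c1 \<and> b1 < 0")
      case True
      \<comment> \<open>On the boundary \<open>a = c1\<close> a swap keeps both outer coefficients
        and repairs the sign of the middle one.\<close>
      have "(c1, - b1, a) \<in> reduced_forms D"
        by (rule reduced_formsI[OF fd]) (use True b1 disc1 c1 in \<open>auto simp: algebra_simps\<close>)
      then show ?thesis by (rule equiv_reduced_swap[OF equiv_reduced_self])
    next
      case nt: False
      have "(a, b1, c1) \<in> reduced_forms D"
        by (rule reduced_formsI[OF fd disc1]) (use False nt b1 less.prems(1) in auto)
      then show ?thesis by (rule equiv_reduced_self)
    qed
  qed
  from equiv_reduced_translate[OF this, of q] show ?case
    unfolding b1_def c1_def by (simp add: power2_eq_square algebra_simps)
qed

text \<open>Chooses one of \<open>(x, y)\<close> and \<open>(- x, - y)\<close> for every nonzero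
  pair. Both give the same value of the form, and the choice halves the lattice count.\<close>

definition upper_half :: "int \<Rightarrow> int \<Rightarrow> bool" where
  "upper_half x y \<longleftrightarrow> y > 0 \<or> (y = 0 \<and> x > 0)"

text \<open>The ideals of norm \<open>n\<close>: the pair \<open>(k, t)\<close> stands for \<open>k\<close> times the primitive ideal of norm
  \<open>m = n div k\<^sup>2\<close> given by a root \<open>t\<close> of the discriminant polynomial modulo \<open>m\<close>.\<close>

definition ideal_data :: "int \<Rightarrow> nat \<Rightarrow> (nat \<times> nat) set" where
  "ideal_data D n = {(k, t). k > 0 \<and> k\<^sup>2 dvd n \<and> t < n div k\<^sup>2 \<and> int (n div k\<^sup>2) dvd disc_poly D (int t)}"

lemma finite_ideal_data:
  assumes n: "n > 0" shows "finite (ideal_data D n)"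
proof (rule finite_subset)
  show "ideal_data D n \<subseteq> {..n} \<times> {..n}"
  proof (rule subrelI, intro SigmaI)
    fix k t assume kt: "(k, t) \<in> ideal_data D n"
    then have "k\<^sup>2 \<le> n" using n by (auto simp: ideal_data_def dest: dvd_imp_le)
    then show "k \<in> {..n}" using self_le_power[of k 2] by (cases "k = 0") auto
    have "t < n div k\<^sup>2" using kt by (auto simp: ideal_data_def)
    then show "t \<in> {..n}"
      using div_le_dividend[of n "k\<^sup>2"] unfolding atMost_iff by linarith
  qed
qed simp

definition half_reps :: "int \<Rightarrow> nat \<Rightarrow> ((int \<times> int \<times> int) \<times> int \<times> int) set" where
  "half_reps D N = {(f, x, y). f \<in> reduced_forms D \<and> upper_half x y \<and> form_val f x y \<le> int N}"

text \<open>The form \<open>(m, 2 * t + D mod 2, _)\<close> is carried to \<open>f\<close> by the matrix with columns \<open>(x, y)\<close>, \<open>(u, v)\<close>.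
  The second column is unique up to multiples of the first, so \<open>(x, y)\<close> determines \<open>t\<close> modulo \<open>m\<close>.\<close>

definition data_rep :: "int \<Rightarrow> nat \<Rightarrow> nat \<Rightarrow> nat \<Rightarrow> (int \<times> int \<times> int) \<times> int \<times> int \<Rightarrow> bool" where
  "data_rep D n k t r = (case r of (f, X, Y) \<Rightarrow> f \<in> reduced_forms D \<and> upper_half X Y \<and>
     form_val f X Y = int n \<and> (\<exists>x y u v. X = int k * x \<and> Y = int k * y \<and> x * v - y * u = 1 \<and>
       form_val f x y = int (n div k\<^sup>2) \<and> form_polar f x y u v = 2 * int t + D mod 2))"

lemma data_rep_exists:
  assumes fd: "fundamental_disc D" and D: "D < 0" and n: "n > 0" and kt: "(k, t) \<in> ideal_data D n"
  shows "\<exists>r. data_rep D n k t r"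
proof -
  define m where "m = n div k\<^sup>2"
  have k: "k > 0" "k\<^sup>2 dvd n" and t: "t < m" and dv: "int m dvd disc_poly D (int t)"
    using kt by (auto simp: ideal_data_def m_def)
  have nm: "n = k\<^sup>2 * m" using k by (simp add: m_def)
  have m: "m > 0" using n nm by (cases m) auto
  obtain c where c: "disc_poly D (int t) = int m * c" using dv by auto
  define b where "b = 2 * int t + D mod 2"
  have "b\<^sup>2 - 4 * int m * c = D"
    using disc_poly_eq[OF fundamental_disc_mod4[OF fd], of "int t"] c unfolding b_def by simp
  then have "equiv_reduced D (int m, b, c)"
    using every_form_equiv_reduced[OF fd D] m by simp
  then obtain f x y u v where f: "f \<in> reduced_forms D" "x * v - y * u = 1"
    "form_val f x y = int m" "form_polar f x y u v = b"
    unfolding equiv_reduced_def by auto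
  \<comment> \<open>Negating both columns preserves the determinant and the coefficients, so the
    first column can be moved into the upper half.\<close>
  have neg: "form_val f (- x) (- y) = form_val f x y" "form_polar f (- x) (- y) (- u) (- v) = form_polar f x y u v"
    unfolding form_val_def form_polar_def by (auto split: prod.splits)
  have scale: "form_val f (int k * z) (int k * w) = int (k\<^sup>2) * form_val f z w" for z w
    unfolding form_val_def by (auto split: prod.splits simp: power2_eq_square algebra_simps)
  have "x \<noteq> 0 \<or> y \<noteq> 0" using f(2) by auto
  then have "upper_half x y \<or> upper_half (- x) (- y)" unfolding upper_half_def by auto
  moreover have up: "upper_half (int k * z) (int k * w)" if "upper_half z w" for z w
    using that k(1) unfolding upper_half_def by (auto simp: zero_less_mult_iff)
  ultimately consider "upper_half (int k * x) (int k * y)" | "upper_half (int k * (- x)) (int k * (- y))"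
    by blast
  then show ?thesis
  proof cases
    case 1
    have "data_rep D n k t (f, int k * x, int k * y)"
      unfolding data_rep_def using f 1 scale[of x y] nm
      unfolding m_def[symmetric] b_def[symmetric] by auto
    then show ?thesis by blast
  next
    case 2
    have "(- x) * (- v) - (- y) * (- u) = 1" using f(2) by simp
    then have "data_rep D n k t (f, int k * (- x), int k * (- y))"
      unfolding data_rep_def using f 2 scale[of "- x" "- y"] nm neg
      unfolding m_def[symmetric] b_def[symmetric] prod.case
      by (intro conjI exI[of _ "- x"] exI[of _ "- y"] exI[of _ "- u"] exI[of _ "- v"]) auto
    then show ?thesis by blast
  qed
qed

lemma data_rep_unique:
  assumes kt: "(k, t) \<in> ideal_data D n" "(k', t') \<in> ideal_data D n'"
    and r: "data_rep D n k t r" "data_rep D n' k' t' r"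
  shows "n = n' \<and> k = k' \<and> t = t'"
proof -
  obtain f X Y where rf: "r = (f, X, Y)" by (cases r)
  obtain x y u v where 1: "X = int k * x" "Y = int k * y" "x * v - y * u = 1"
    "form_val f x y = int (n div k\<^sup>2)" "form_polar f x y u v = 2 * int t + D mod 2" "form_val f X Y = int n"
    using r(1) unfolding rf data_rep_def by auto
  obtain x' y' u' v' where 2: "X = int k' * x'" "Y = int k' * y'" "x' * v' - y' * u' = 1"
    "form_val f x' y' = int (n' div k'\<^sup>2)" "form_polar f x' y' u' v' = 2 * int t' + D mod 2" "form_val f X Y = int n'"
    using r(2) unfolding rf data_rep_def by auto
  have n: "n = n'" using 1(6) 2(6) by simp
  have k0: "k > 0" "k' > 0" using kt by (auto simp: ideal_data_def)
  have cop: "coprime z w" if "z * v - w * u = 1" for z w u v :: int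
  proof (rule coprimeI)
    fix c assume "c dvd z" "c dvd w"
    then have "c dvd z * v - w * u" by simp
    then show "is_unit c" using that by simp
  qed
  \<comment> \<open>Determinant 1 makes \<open>(x, y)\<close> primitive, so \<open>k\<close> is
    recovered from the represented vector as its content.\<close>
  have "gcd X Y = int k"
    unfolding 1(1,2) using cop[OF 1(3)] k0 by (simp add: gcd_mult_left)
  moreover have "gcd X Y = int k'"
    unfolding 2(1,2) using cop[OF 2(3)] k0 by (simp add: gcd_mult_left)
  ultimately have k: "k = k'" by simp
  have xy: "x' = x" "y' = y" using 1(1,2) 2(1,2) k k0 by auto
  define m where "m = n div k\<^sup>2"
  \<comment> \<open>Cramer's rule: the two second columns have determinant 1 with the same first
    column, hence differ by \<open>s\<close> times it.\<close>
  define s where "s = v * u' - u * v'"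
  have su: "u' = u + s * x"
  proof -
    have "u' - u = u' * (x * v - y * u) - u * (x * v' - y * u')" using 1(3) 2(3) xy by simp
    also have "\<dots> = s * x" unfolding s_def by (simp add: algebra_simps)
    finally show ?thesis by simp
  qed
  have sv: "v' = v + s * y"
  proof -
    have "v' - v = v' * (x * v - y * u) - v * (x * v' - y * u')" using 1(3) 2(3) xy by simp
    also have "\<dots> = s * y" unfolding s_def by (simp add: algebra_simps)
    finally show ?thesis by simp
  qed
  have "form_polar f x y u' v' = form_polar f x y u v + 2 * s * form_val f x y"
    unfolding su sv form_polar_def form_val_def
    by (auto split: prod.splits simp: power2_eq_square algebra_simps)
  then have "int t' = int t + s * int m" using 1(4,5) 2(5) xy by (simp add: m_def)
  then have "int t' mod int m = int t mod int m" by simp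
  moreover have "t < m" "t' < m" using kt k n by (auto simp: ideal_data_def m_def)
  ultimately have "t = t'" by simp
  with n k show ?thesis by simp
qed

lemma sum_ideal_data_le:
  assumes fd: "fundamental_disc D" and D: "D < 0" and fin: "finite (half_reps D N)"
  shows "(\<Sum>n=1..N. card (ideal_data D n)) \<le> card (half_reps D N)"
proof -
  define g where "g = (\<lambda>(n, k, t). SOME r. data_rep D n k t r)"
  let ?S = "Sigma {1..N} (ideal_data D)"
  have g: "data_rep D n k t (g (n, k, t))" if "(n, k, t) \<in> ?S" for n k t
    using that data_rep_exists[OF fd D, of n k t] unfolding g_def by (auto intro: someI_ex)
  have "card ?S \<le> card (half_reps D N)"
  proof (rule card_inj_on_le[OF _ _ fin])
    show "inj_on g ?S"
    proof (rule inj_onI)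
      fix z z' assume z: "z \<in> ?S" "z' \<in> ?S" "g z = g z'"
      obtain n k t n' k' t' where zz: "z = (n, k, t)" "z' = (n', k', t')"
        by (metis prod_cases3)
      have "data_rep D n k t (g z)" "data_rep D n' k' t' (g z)"
        using g z unfolding zz by metis+
      moreover have "(k, t) \<in> ideal_data D n" "(k', t') \<in> ideal_data D n'"
        using z unfolding zz by auto
      ultimately show "z = z'" using data_rep_unique unfolding zz by blast
    qed
    show "g ` ?S \<subseteq> half_reps D N"
    proof (clarify)
      fix n k t f x y assume a: "n \<in> {1..N}" "(k, t) \<in> ideal_data D n" "(f, x, y) = g (n, k, t)"
      then have "data_rep D n k t (f, x, y)" using g by simp
      then show "(f, x, y) \<in> half_reps D N"
        using a(1) by (auto simp: data_rep_def half_reps_def)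
    qed
  qed
  then show ?thesis using finite_ideal_data by simp
qed

section \<open>Counting ideals\<close>

lemma disc_poly_diff:
  "disc_poly D (t + z) = disc_poly D t + z * (2 * t + D mod 2) + z\<^sup>2"
  unfolding disc_poly_def by (simp add: power2_eq_square algebra_simps)

lemma disc_poly_cong:
  assumes "[s = t] (mod m)" shows "m dvd disc_poly D s \<longleftrightarrow> m dvd disc_poly D t"
proof -
  obtain z where "s = t + m * z" using assms
    by (metis cong_iff_lin cong_sym mult.commute)
  then have "disc_poly D s = disc_poly D t + m * (z * (2 * t + D mod 2) + m * z\<^sup>2)"
    by (simp add: disc_poly_diff power2_eq_square algebra_simps)
  then show ?thesis by (metis dvd_add_left_iff dvd_triv_left)
qed

text \<open>The derivative \<open>2 * t + D mod 2\<close> squares to \<open>D\<close> modulo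
  \<open>p\<close> at a root, so it is invertible when \<open>p\<close> does not divide
  \<open>D\<close>. This argument also covers \<open>p = 2\<close>.\<close>

lemma disc_poly_hensel:
  fixes p t :: int
  assumes D: "D mod 4 = 0 \<or> D mod 4 = 1" and p: "prime p" "\<not> p dvd D" and t: "p dvd disc_poly D t"
  shows "\<exists>t'. [t' = t] (mod p) \<and> p ^ Suc s dvd disc_poly D t'"
proof (induction s)
  case 0
  then show ?case using t by (intro exI[of _ t]) simp
next
  case (Suc s)
  then obtain t' where t': "[t' = t] (mod p)" "p ^ Suc s dvd disc_poly D t'" by blast
  then obtain w where w: "disc_poly D t' = p ^ Suc s * w" by auto
  let ?l = "2 * t' + D mod 2"
  have "\<not> p dvd ?l"
  proof
    assume l: "p dvd ?l"
    have "D = ?l\<^sup>2 - 4 * disc_poly D t'" using disc_poly_eq[OF D, of t'] by simp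
    moreover have "p dvd disc_poly D t'" using w by simp
    ultimately show False using p(2) l
      by (metis dvd_diff dvd_mult power2_eq_square)
  qed
  then have "coprime ?l p" using p(1) prime_imp_coprime coprime_commute by metis
  then obtain i where i: "[?l * i = 1] (mod p)" using cong_solve_coprime_int by blast
  \<comment> \<open>Newton step: \<open>z\<close> solves \<open>w + z * ?l \<equiv> 0\<close> modulo
    \<open>p\<close>, and the quadratic error term already contains
    \<open>p ^ Suc (Suc s)\<close>.\<close>
  define z where "z = - w * i"
  have "[w + z * ?l = w - w * (?l * i)] (mod p)" by (simp add: z_def algebra_simps)
  also have "[w - w * (?l * i) = w - w * 1] (mod p)" by (intro cong_diff cong_mult cong_refl i)
  finally have "p dvd w + z * ?l" by (simp add: cong_0_iff)
  then obtain v where v: "w + z * ?l = p * v" by auto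
  have "disc_poly D (t' + p ^ Suc s * z) = p ^ Suc s * (w + z * ?l) + (p ^ Suc s * z)\<^sup>2"
    unfolding disc_poly_diff w by (simp add: algebra_simps)
  also have "\<dots> = p ^ Suc (Suc s) * (v + p ^ s * z\<^sup>2)"
    unfolding v by (simp add: power2_eq_square algebra_simps)
  finally have "p ^ Suc (Suc s) dvd disc_poly D (t' + p ^ Suc s * z)" by simp
  moreover have "[t' + p ^ Suc s * z = t] (mod p)"
  proof -
    have "[t' + p * (p ^ s * z) = t'] (mod p)" by (simp add: cong_def)
    then have "[t' + p ^ Suc s * z = t'] (mod p)" by (simp add: mult.assoc)
    then show ?thesis using t'(1) by (rule cong_trans)
  qed
  ultimately show ?case by blast
qed

text \<open>Completing the square backwards requires \<open>y\<close> to have the parity of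
  \<open>D\<close>; adding the odd \<open>p\<close> corrects it if necessary. The congruence with
  \<open>y\<close> is kept so that roots coming from \<open>y\<close> and \<open>- y\<close> can be
  told apart.\<close>

lemma disc_poly_root_of_square:
  fixes p y :: int
  assumes D: "D mod 4 = 0 \<or> D mod 4 = 1" and p: "prime p" "odd p" and y: "p dvd y\<^sup>2 - D"
  shows "\<exists>t. [2 * t + D mod 2 = y] (mod p) \<and> p dvd disc_poly D t"
proof -
  define y' where "y' = (if even y = even D then y else y + p)"
  have par: "even y' = even D" using p(2) by (auto simp: y'_def)
  have yy: "[y' = y] (mod p)" by (simp add: y'_def cong_def)
  define t where "t = (y' - D mod 2) div 2"
  have t: "2 * t + D mod 2 = y'" using par unfolding t_def by presburger
  have "[y'\<^sup>2 - D = y\<^sup>2 - D] (mod p)" by (intro cong_diff cong_pow yy cong_refl)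
  then have "p dvd y'\<^sup>2 - D" using y cong_dvd_iff by blast
  then have "p dvd 4 * disc_poly D t" using disc_poly_eq[OF D, of t] t by simp
  moreover have "\<not> p dvd 4"
  proof
    assume "p dvd 4"
    then have "p dvd 2 ^ 2" by simp
    then have "p dvd 2" using p(1) prime_dvd_power by blast
    then have "p = 2" by (rule primes_dvd_imp_eq[OF p(1), rotated]) simp
    then show False using p(2) by simp
  qed
  ultimately have "p dvd disc_poly D t" using p(1) prime_dvd_mult_iff by blast
  then show ?thesis using t yy by metis
qed

lemma kron_prime_zero_root:
  assumes D: "D mod 4 = 0 \<or> D mod 4 = 1" and p: "prime p" and k: "kron_prime D p = 0"
  shows "\<exists>t. int p dvd disc_poly D t"
proof (cases "p = 2")
  case True
  then have "even D" using k by (auto simp: kron_prime_def split: if_splits)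
  then have "D mod 2 = 0" by presburger
  \<comment> \<open>For even \<open>D\<close> the polynomial is \<open>t\<^sup>2 - D div 4\<close>,
    and \<open>m\<^sup>2 - m\<close> is always even.\<close>
  then have "even (disc_poly D (D div 4))" by (simp add: disc_poly_def)
  then show ?thesis using True by auto
next
  case False
  then have odd: "odd p" using p prime_odd_nat prime_ge_2_nat[OF p] by auto
  have "int p dvd D" using k False
    by (simp add: kron_prime_def Legendre_def cong_0_iff split: if_splits)
  then show ?thesis using disc_poly_root_of_square[OF D, of "int p" 0] p odd by auto
qed

lemma kron_prime_one_roots:
  assumes D: "D mod 4 = 0 \<or> D mod 4 = 1" and p: "prime p" and k: "kron_prime D p = 1"
  shows "\<not> int p dvd D \<and> (\<exists>t t'. int p dvd disc_poly D t \<and> int p dvd disc_poly D t' \<and> \<not> [t = t'] (mod int p))"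
proof (cases "p = 2")
  case True
  then have "odd D" and "D mod 8 = 1 \<or> D mod 8 = 7"
    using k by (auto simp: kron_prime_def split: if_splits)
  then have "odd D" "D mod 2 = 1" "even (D div 4)" using D by presburger+
  \<comment> \<open>Here \<open>D mod 8 = 1\<close>, so the polynomial is
    \<open>t\<^sup>2 + t\<close> minus an even number and both residues modulo 2 are roots.\<close>
  then have "even (disc_poly D 0)" "even (disc_poly D 1)" by (simp_all add: disc_poly_def)
  moreover have "\<not> [0 = 1] (mod (2::int))" by (simp add: cong_def)
  ultimately show ?thesis using True \<open>odd D\<close> by auto
next
  case False
  then have odd: "odd p" using p prime_odd_nat prime_ge_2_nat[OF p] by auto
  have L: "\<not> int p dvd D" "QuadRes (int p) D" using k False
    by (auto simp: kron_prime_def Legendre_def cong_0_iff split: if_splits)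
  then obtain y where y: "[y\<^sup>2 = D] (mod int p)" unfolding QuadRes_def by blast
  then have "int p dvd y\<^sup>2 - D" by (simp add: cong_iff_dvd_diff)
  then obtain t t' where t: "[2 * t + D mod 2 = y] (mod int p)" "int p dvd disc_poly D t"
    "[2 * t' + D mod 2 = - y] (mod int p)" "int p dvd disc_poly D t'"
    using disc_poly_root_of_square[OF D, of "int p" y] disc_poly_root_of_square[OF D, of "int p" "- y"] p odd
    by auto
  have "\<not> [t = t'] (mod int p)"
  proof
    assume "[t = t'] (mod int p)"
    then have "[2 * t + D mod 2 = 2 * t' + D mod 2] (mod int p)"
      by (intro cong_add cong_mult cong_refl)
    then have "[y = - y] (mod int p)" using t(1,3) by (metis cong_sym cong_trans)
    then have "int p dvd 2 * y" by (simp add: cong_iff_dvd_diff)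
    moreover have "\<not> int p dvd 2"
      using False p by (metis int_dvd_int_iff of_nat_numeral primes_dvd_imp_eq two_is_prime_nat)
    ultimately have "int p dvd y" using p prime_dvd_mult_iff by (metis prime_nat_int_transfer)
    then have "int p dvd y\<^sup>2" by (simp add: power2_eq_square)
    then show False using y L(1) cong_dvd_iff by blast
  qed
  then show ?thesis using L t by blast
qed

lemma disc_poly_root_nat:
  assumes "int m dvd disc_poly D t" "m > 0"
  obtains r where "r < m" "int m dvd disc_poly D (int r)" "[int r = t] (mod int m)"
proof
  have *: "int (nat (t mod int m)) = t mod int m" using assms by simp
  show c: "[int (nat (t mod int m)) = t] (mod int m)" unfolding * by (simp add: cong_def)
  show "int m dvd disc_poly D (int (nat (t mod int m)))"
    using disc_poly_cong[OF c] assms by simp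
  show "nat (t mod int m) < m" using assms by (simp add: nat_less_iff)
qed

lemma ideal_data_prime_power_mem:
  assumes p: "prime p" and j: "2 * j \<le> e"
  shows "(p ^ j, t) \<in> ideal_data D (p ^ e) \<longleftrightarrow>
    t < p ^ (e - 2 * j) \<and> int (p ^ (e - 2 * j)) dvd disc_poly D (int t)"
proof -
  have p0: "p > 0" using p prime_gt_0_nat by blast
  have "p ^ e = (p ^ j)\<^sup>2 * p ^ (e - 2 * j)"
    using j by (simp add: power_mult[symmetric] power_add[symmetric] mult.commute)
  then have "(p ^ j)\<^sup>2 dvd p ^ e" "p ^ e div (p ^ j)\<^sup>2 = p ^ (e - 2 * j)" using p0 by auto
  then show ?thesis using p0 by (simp add: ideal_data_def)
qed

lemma sum_power_int:
  fixes c :: int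
  assumes "c \<in> {-1, 0, 1}"
  shows "(\<Sum>i\<le>e. c ^ i) = (if c = 1 then int e + 1 else if c = 0 \<or> even e then 1 else 0)"
  using assms by (induction e) auto

text \<open>The sum is \<open>e + 1\<close> for a split prime, 1 for a ramified one, and 1 or 0 by
  the parity of \<open>e\<close> for an inert one. In each case that many ideals of norm
  \<open>p ^ e\<close> are exhibited.\<close>

lemma ideal_data_prime_power:
  assumes D: "D mod 4 = 0 \<or> D mod 4 = 1" and p: "prime p"
    and k: "kron_prime D p \<in> {-1, 0, 1}"
  shows "(\<Sum>i\<le>e. kron_prime D p ^ i) \<le> int (card (ideal_data D (p ^ e)))"
proof -
  have p0: "p > 0" and p1: "p > 1" using p prime_gt_0_nat prime_gt_1_nat by blast+
  have fin: "finite (ideal_data D (p ^ e))" using p0 by (intro finite_ideal_data) simp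
  have card1: "card (ideal_data D (p ^ e)) \<ge> 1" if "x \<in> ideal_data D (p ^ e)" for x
    using that fin by (metis One_nat_def Suc_leI card_gt_0_iff empty_iff)
  show ?thesis
  proof (cases "kron_prime D p = 1")
    case True
    then obtain t t' where nD: "\<not> int p dvd D" and t: "int p dvd disc_poly D t" "int p dvd disc_poly D t'"
      "\<not> [t = t'] (mod int p)"
      using kron_prime_one_roots[OF D p True] by blast
    have ip: "prime (int p)" using p by simp
    have ex: "\<exists>r0 r1. r0 < p ^ s \<and> int (p ^ s) dvd disc_poly D (int r0) \<and>
      (s > 0 \<longrightarrow> r1 < p ^ s \<and> int (p ^ s) dvd disc_poly D (int r1) \<and> r0 \<noteq> r1)" for s
    proof (cases s)
      case 0
      then show ?thesis by (intro exI[of _ 0]) auto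
    next
      case (Suc s')
      obtain u u' where u: "[u = t] (mod int p)" "int p ^ s dvd disc_poly D u"
          "[u' = t'] (mod int p)" "int p ^ s dvd disc_poly D u'"
        using disc_poly_hensel[OF D ip nD t(1), of s'] disc_poly_hensel[OF D ip nD t(2), of s'] Suc by auto
      have ps: "p ^ s > 0" using p0 by simp
      obtain r0 where r0: "r0 < p ^ s" "int (p ^ s) dvd disc_poly D (int r0)" "[int r0 = u] (mod int (p ^ s))"
        using disc_poly_root_nat[OF _ ps, of D u] u by auto
      obtain r1 where r1: "r1 < p ^ s" "int (p ^ s) dvd disc_poly D (int r1)" "[int r1 = u'] (mod int (p ^ s))"
        using disc_poly_root_nat[OF _ ps, of D u'] u by auto
      have "int p dvd int (p ^ s)" using Suc by simp
      then have "[int r0 = u] (mod int p)" "[int r1 = u'] (mod int p)"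
        using r0(3) r1(3) cong_dvd_modulus by blast+
      then have "r0 \<noteq> r1" using t(3) u(1,3) by (metis cong_sym cong_trans)
      then show ?thesis using r0 r1 by blast
    qed
    then obtain r0 r1 where r: "\<And>s. r0 s < p ^ s \<and> int (p ^ s) dvd disc_poly D (int (r0 s)) \<and>
      (s > 0 \<longrightarrow> r1 s < p ^ s \<and> int (p ^ s) dvd disc_poly D (int (r1 s)) \<and> r0 s \<noteq> r1 s)"
      by metis
    \<comment> \<open>The index \<open>i\<close> encodes the content \<open>p ^ (i div 2)\<close>
      and, by its parity, one of two distinct roots. Modulo 1 there is only one root, and it is used
      only once, for \<open>i = e\<close> even.\<close>
    define g where "g i = (p ^ (i div 2), (if even i then r0 else r1) (e - 2 * (i div 2)))" for i
    have "card {..e} \<le> card (ideal_data D (p ^ e))"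
    proof (rule card_inj_on_le[OF _ _ fin])
      show "inj_on g {..e}"
      proof (rule inj_onI)
        fix i j assume ij: "i \<in> {..e}" "j \<in> {..e}" "g i = g j"
        then have h: "i div 2 = j div 2" using p1 by (simp add: g_def power_inject_exp)
        have "even i = even j"
        proof (rule ccontr)
          assume ne: "even i \<noteq> even j"
          have "i \<le> e" "j \<le> e" using ij by simp_all
          with ne h have "2 * (i div 2) < e" by presburger
          then have "r0 (e - 2 * (i div 2)) \<noteq> r1 (e - 2 * (i div 2))" using r by simp
          then show False using ij(3) h ne by (auto simp: g_def split: if_splits)
        qed
        then show "i = j" using h by presburger
      qed
      show "g ` {..e} \<subseteq> ideal_data D (p ^ e)"
      proof (rule image_subsetI)
        fix i assume "i \<in> {..e}"
        then have i: "i \<le> e" by simp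
        then have j: "2 * (i div 2) \<le> e" by simp
        have "odd i \<Longrightarrow> e - 2 * (i div 2) > 0" using i by presburger
        then show "g i \<in> ideal_data D (p ^ e)"
          unfolding g_def ideal_data_prime_power_mem[OF p j] using r by auto
      qed
    qed
    then show ?thesis using True sum_power_int[OF k] by simp
  next
    case False
    show ?thesis
    proof (cases "even e")
      case True
      then obtain j where j: "e = 2 * j" by (auto elim: evenE)
      \<comment> \<open>The principal ideal generated by \<open>p ^ j\<close>; its primitive part
        has norm 1, where 0 is the only residue.\<close>
      have "(p ^ j, 0) \<in> ideal_data D (p ^ e)"
        using ideal_data_prime_power_mem[OF p, of j e 0] j by simp
      then have "card (ideal_data D (p ^ e)) \<ge> 1" by (rule card1)
      then show ?thesis using False sum_power_int[OF k] by simp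
    next
      case odd: False
      show ?thesis
      proof (cases "kron_prime D p = 0")
        case True
        obtain t where t: "int p dvd disc_poly D t" using kron_prime_zero_root[OF D p True] by blast
        obtain r where r: "r < p" "int p dvd disc_poly D (int r)"
          using disc_poly_root_nat[OF t p0] by blast
        obtain j where j: "e = 2 * j + 1" using odd by (auto elim: oddE)
        \<comment> \<open>\<open>p ^ j\<close> times the ramified prime ideal above
          \<open>p\<close>.\<close>
        have "(p ^ j, r) \<in> ideal_data D (p ^ e)"
          using ideal_data_prime_power_mem[OF p, of j e r] j r by simp
        then have "card (ideal_data D (p ^ e)) \<ge> 1" by (rule card1)
        then show ?thesis using False True sum_power_int[OF k] by simp
      next
        case nz: False
        then show ?thesis using False odd sum_power_int[OF k] by simp
      qed
    qed
  qed
qed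

section \<open>From prime powers to all norms\<close>

lemma gcd_coprime_product:
  fixes m n :: nat
  assumes cop: "coprime m n" and x: "x dvd m" and y: "y dvd n"
  shows "gcd (x * y) m = x"
proof -
  have "coprime y m" using cop y by (meson coprime_commute coprime_divisors dvd_refl)
  then have "gcd (x * y) m = gcd x m"
    by (simp add: gcd_mult_right_right_cancel gcd.commute mult.commute coprime_commute)
  then show ?thesis using x by (simp add: gcd_nat.absorb1)
qed

text \<open>Contents multiply and roots are glued by the Chinese remainder theorem. Since only a
  lower bound for the ideal count is wanted, injectivity of the gluing is enough.\<close>

lemma card_ideal_data_mult:
  assumes cop: "coprime m n" and m: "m > 0" and n: "n > 0"
  shows "card (ideal_data D m) * card (ideal_data D n) \<le> card (ideal_data D (m * n))"
proof -
  define Q where "Q = (\<lambda>((k1, t1), (k2, t2)) (k, t). k = k1 * k2 \<and> [t = t1] (mod (m div k1\<^sup>2)) \<and>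
     [t = t2] (mod (n div k2\<^sup>2)) \<and> (k, t) \<in> ideal_data D (m * n))"
  have ex: "\<exists>r. Q z r" if z: "z \<in> ideal_data D m \<times> ideal_data D n" for z
  proof -
    obtain k1 t1 k2 t2 where zz: "z = ((k1, t1), (k2, t2))" by (metis surj_pair)
    have 1: "k1 > 0" "k1\<^sup>2 dvd m" "t1 < m div k1\<^sup>2" "int (m div k1\<^sup>2) dvd disc_poly D (int t1)"
      and 2: "k2 > 0" "k2\<^sup>2 dvd n" "t2 < n div k2\<^sup>2" "int (n div k2\<^sup>2) dvd disc_poly D (int t2)"
      using z unfolding zz ideal_data_def by auto
    obtain a where a: "m = k1\<^sup>2 * a" using 1(2) by auto
    obtain b where b: "n = k2\<^sup>2 * b" using 2(2) by auto
    have ab: "m div k1\<^sup>2 = a" "n div k2\<^sup>2 = b" using 1(1) 2(1) a b by auto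
    have pos: "a > 0" "b > 0" using a b m n by (auto intro!: Nat.gr0I)
    have cab: "coprime a b" using cop unfolding a b by auto
    obtain t where t: "t < a * b" "[t = t1] (mod a)" "[t = t2] (mod b)"
      using binary_chinese_remainder_unique_nat[OF cab, of t1 t2] pos by auto
    have "int a dvd disc_poly D (int t)" "int b dvd disc_poly D (int t)"
      using disc_poly_cong[of "int t" "int t1" "int a" D] disc_poly_cong[of "int t" "int t2" "int b" D]
        t(2,3) 1(4) 2(4) unfolding ab by (auto simp: cong_int_iff)
    then have "int (a * b) dvd disc_poly D (int t)"
      using cab by (simp add: divides_mult)
    moreover have mn: "m * n = (k1 * k2)\<^sup>2 * (a * b)" unfolding a b by (simp add: power2_eq_square algebra_simps)
    moreover have "m * n div (k1 * k2)\<^sup>2 = a * b" unfolding mn using 1(1) 2(1) by simp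
    ultimately have "(k1 * k2, t) \<in> ideal_data D (m * n)"
      using t(1) 1(1) 2(1) unfolding ideal_data_def by auto
    then have "Q z (k1 * k2, t)" unfolding Q_def zz using t ab by auto
    then show ?thesis by blast
  qed
  define g where "g z = (SOME r. Q z r)" for z
  have g: "Q z (g z)" if "z \<in> ideal_data D m \<times> ideal_data D n" for z
    unfolding g_def using ex[OF that] by (rule someI_ex)
  have "card (ideal_data D m \<times> ideal_data D n) \<le> card (ideal_data D (m * n))"
  proof (rule card_inj_on_le)
    show "finite (ideal_data D (m * n))" using m n by (intro finite_ideal_data) simp
    show "g ` (ideal_data D m \<times> ideal_data D n) \<subseteq> ideal_data D (m * n)"
    proof
      fix r assume "r \<in> g ` (ideal_data D m \<times> ideal_data D n)"
      then obtain z where "z \<in> ideal_data D m \<times> ideal_data D n" "r = g z" by blast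
      then have "Q z r" using g by simp
      then show "r \<in> ideal_data D (m * n)" unfolding Q_def by (auto split: prod.splits)
    qed
    show "inj_on g (ideal_data D m \<times> ideal_data D n)"
    proof (rule inj_onI)
      fix z z' assume z: "z \<in> ideal_data D m \<times> ideal_data D n" "z' \<in> ideal_data D m \<times> ideal_data D n" "g z = g z'"
      obtain k1 t1 k2 t2 where zz: "z = ((k1, t1), (k2, t2))" by (metis surj_pair)
      obtain k1' t1' k2' t2' where zz': "z' = ((k1', t1'), (k2', t2'))" by (metis surj_pair)
      obtain k t where kt: "g z = (k, t)" by (cases "g z")
      have Q: "Q z (k, t)" "Q z' (k, t)" using g z kt by metis+
      then have k: "k = k1 * k2" "k = k1' * k2'" unfolding Q_def zz zz' by auto
      have b: "k1 > 0" "k1\<^sup>2 dvd m" "t1 < m div k1\<^sup>2" "k1' > 0" "k1'\<^sup>2 dvd m" "t1' < m div k1'\<^sup>2"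
        "k2 > 0" "k2\<^sup>2 dvd n" "t2 < n div k2\<^sup>2" "k2' > 0" "k2'\<^sup>2 dvd n" "t2' < n div k2'\<^sup>2"
        using z(1,2) unfolding zz zz' ideal_data_def by auto
      have dv: "k1 dvd m" "k1' dvd m" "k2 dvd n" "k2' dvd n"
        using b by (meson dvd_power dvd_trans pos2)+
      \<comment> \<open>Coprimality of \<open>m\<close> and \<open>n\<close> lets the content be
        split again: \<open>k1\<close> is the gcd of \<open>k\<close> and \<open>m\<close>.\<close>
      have k1: "k1 = k1'" using gcd_coprime_product[OF cop dv(1,3)] gcd_coprime_product[OF cop dv(2,4)] k by simp
      then have k2: "k2 = k2'" using k b(1) by simp
      have "t1 = t1'"
        using Q b(3,6) k1 unfolding Q_def zz zz' by (auto simp: cong_def)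
      moreover have "t2 = t2'"
        using Q b(9,12) k2 unfolding Q_def zz zz' by (auto simp: cong_def)
      ultimately show "z = z'" using k1 k2 zz zz' by simp
    qed
  qed
  then show ?thesis by (simp add: card_cartesian_product)
qed

lemma sum_divisors_coprime_mult:
  fixes f :: "nat \<Rightarrow> int"
  assumes f: "\<And>a b. f (a * b) = f a * f b" and cop: "coprime m n" and m: "m > 0" and n: "n > 0"
  shows "(\<Sum>k | k dvd m * n. f k) = (\<Sum>k | k dvd m. f k) * (\<Sum>k | k dvd n. f k)"
proof -
  have "bij_betw (\<lambda>(a, b). a * b) ({k. k dvd m} \<times> {k. k dvd n}) {k. k dvd m * n}"
  proof (rule bij_betwI')
    fix z z' assume z: "z \<in> {k. k dvd m} \<times> {k. k dvd n}" "z' \<in> {k. k dvd m} \<times> {k. k dvd n}"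
    show "((case z of (a, b) \<Rightarrow> a * b) = (case z' of (a, b) \<Rightarrow> a * b)) = (z = z')"
    proof (cases z; cases z')
      fix a b a' b' assume zz: "z = (a, b)" "z' = (a', b')"
      have "a = a' \<and> b = b'" if "a * b = a' * b'"
      proof -
        have "a = a'" using gcd_coprime_product[OF cop, of a b] gcd_coprime_product[OF cop, of a' b'] z that
          unfolding zz by auto
        moreover have "a > 0" using z m unfolding zz by (auto intro!: Nat.gr0I)
        ultimately show ?thesis using that by simp
      qed
      then show ?thesis unfolding zz by auto
    qed
  next
    fix z assume "z \<in> {k. k dvd m} \<times> {k. k dvd n}"
    then show "(case z of (a, b) \<Rightarrow> a * b) \<in> {k. k dvd m * n}" by (auto intro: mult_dvd_mono)
  next
    fix k assume "k \<in> {k. k dvd m * n}"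
    then obtain a b where "k = a * b" "a dvd m" "b dvd n" using division_decomp by blast
    then show "\<exists>z\<in>{k. k dvd m} \<times> {k. k dvd n}. k = (case z of (a, b) \<Rightarrow> a * b)" by auto
  qed
  then have "(\<Sum>k | k dvd m * n. f k) = (\<Sum>z\<in>{k. k dvd m} \<times> {k. k dvd n}. f (case z of (a, b) \<Rightarrow> a * b))"
    by (rule sum.reindex_bij_betw[symmetric])
  also have "\<dots> = (\<Sum>k | k dvd m. f k) * (\<Sum>k | k dvd n. f k)"
    by (simp add: sum_product sum.cartesian_product f case_prod_unfold)
  finally show ?thesis .
qed

text \<open>Induction strips a full prime power from \<open>n\<close>. The divisor sum is
  multiplicative and the ideal count supermultiplicative; the two inequalities can be multiplied
  because the divisor sum at a prime power is nonnegative.\<close>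

lemma sum_divisors_le_card_ideal_data:
  fixes f :: "nat \<Rightarrow> int"
  assumes D: "D mod 4 = 0 \<or> D mod 4 = 1"
    and mult: "\<And>a b. f (a * b) = f a * f b" and one: "f 1 = 1" and val: "\<And>n. f n \<in> {-1, 0, 1}"
    and pr: "\<And>q. prime q \<Longrightarrow> f q = kron_prime D q" and n: "n > 0"
  shows "(\<Sum>k | k dvd n. f k) \<le> int (card (ideal_data D n))"
  using n
proof (induction n rule: less_induct)
  case (less n)
  show ?case
  proof (cases "n = 1")
    case True
    have "(1, 0) \<in> ideal_data D 1" by (auto simp: ideal_data_def)
    then have "card (ideal_data D 1) \<ge> 1"
      using finite_ideal_data[of 1 D] by (metis One_nat_def Suc_leI card_gt_0_iff empty_iff zero_less_one)
    then show ?thesis using True one by simp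
  next
    case False
    then obtain p where p: "prime p" "p dvd n" using prime_factor_nat by blast
    define e where "e = multiplicity p n"
    obtain m where nm: "n = p ^ e * m" "\<not> p dvd m"
      using multiplicity_decompose'[of n p] p less.prems unfolding e_def
      by (metis not_prime_unit not_less_zero)
    have e0: "e > 0" unfolding e_def using p less.prems
      by (metis multiplicity_gt_zero_iff neq0_conv not_prime_unit)
    have m0: "m > 0" using nm less.prems by (auto intro!: Nat.gr0I)
    have p1: "p > 1" using p prime_gt_1_nat by blast
    have mn: "m < n" unfolding nm(1) using m0 one_less_power[OF p1 e0] by simp
    have cop: "coprime (p ^ e) m" using nm(2) p(1) by (simp add: prime_imp_coprime)
    have fpow: "f (p ^ i) = kron_prime D p ^ i" for i
      by (induction i) (use one pr[OF p(1)] in \<open>auto simp: mult\<close>)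
    have "(\<Sum>k | k dvd p ^ e. f k) = (\<Sum>i\<le>e. kron_prime D p ^ i)"
    proof -
      have "{k. k dvd p ^ e} = (\<lambda>i. p ^ i) ` {..e}"
        using divides_primepow_nat[OF p(1)] by auto
      moreover have "inj_on (\<lambda>i. p ^ i) {..e}" using p1 by (auto simp: inj_on_def)
      ultimately show ?thesis by (simp add: sum.reindex fpow)
    qed
    moreover have kv: "kron_prime D p \<in> {-1, 0, 1}" using val[of p] pr[OF p(1)] by simp
    moreover have "(\<Sum>i\<le>e. kron_prime D p ^ i) \<ge> 0" using sum_power_int[OF kv, of e] by simp
    ultimately have pe: "0 \<le> (\<Sum>k | k dvd p ^ e. f k)" "(\<Sum>k | k dvd p ^ e. f k) \<le> int (card (ideal_data D (p ^ e)))"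
      using ideal_data_prime_power[OF D p(1) kv, of e] by simp_all
    have "(\<Sum>k | k dvd n. f k) = (\<Sum>k | k dvd p ^ e. f k) * (\<Sum>k | k dvd m. f k)"
      unfolding nm(1) using p1 m0 by (intro sum_divisors_coprime_mult mult cop) auto
    also have "\<dots> \<le> (\<Sum>k | k dvd p ^ e. f k) * int (card (ideal_data D m))"
      by (rule mult_left_mono[OF less.IH[OF mn m0] pe(1)])
    also have "\<dots> \<le> int (card (ideal_data D (p ^ e))) * int (card (ideal_data D m))"
      by (rule mult_right_mono[OF pe(2)]) simp
    also have "\<dots> \<le> int (card (ideal_data D n))"
      using card_ideal_data_mult[OF cop, of D] p1 m0 unfolding nm(1)
      by (metis gr0I not_less_zero of_nat_le_iff of_nat_mult power_not_zero)
    finally show ?thesis .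
  qed
qed

section \<open>The upper bound for L(1)\<close>

lemma finite_real_interval_int: "finite {x::int. l \<le> real_of_int x \<and> real_of_int x \<le> r}"
proof -
  have "{x::int. l \<le> real_of_int x \<and> real_of_int x \<le> r} = {\<lceil>l\<rceil>..\<lfloor>r\<rfloor>}"
    by (auto simp: ceiling_le_iff le_floor_iff)
  then show ?thesis by simp
qed

text \<open>The hypothesis makes the bound nonnegative, which is what an interval without integers
  requires.\<close>

lemma card_real_interval_int:
  assumes "l \<le> r + 1"
  shows "real (card {x::int. l \<le> real_of_int x \<and> real_of_int x \<le> r}) \<le> r - l + 1"
proof -
  have "{x::int. l \<le> real_of_int x \<and> real_of_int x \<le> r} = {\<lceil>l\<rceil>..\<lfloor>r\<rfloor>}"
    by (auto simp: ceiling_le_iff le_floor_iff)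
  then have "card {x::int. l \<le> real_of_int x \<and> real_of_int x \<le> r} = nat (\<lfloor>r\<rfloor> - \<lceil>l\<rceil> + 1)"
    by simp
  then show ?thesis using assms by (cases "0 \<le> \<lfloor>r\<rfloor> - \<lceil>l\<rceil> + 1") (simp_all, linarith)
qed

text \<open>Completing the square, \<open>4 * a * f(x, y) = (2 * a * x + b * y)\<^sup>2 + d *
  y\<^sup>2\<close>. Each summand is at most \<open>4 * a * N\<close>, so \<open>y\<close> has range
  \<open>2 * sqrt (a * N / d)\<close>, and for fixed \<open>y\<close> the variable \<open>x\<close>
  runs through an interval of length \<open>2 * sqrt (N / a)\<close>. The product of the two lengths
  is \<open>4 * N / sqrt d\<close>, independent of \<open>a\<close>.\<close>

lemma card_form_reps:
  fixes a b c :: int and N :: nat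
  assumes a: "a > 0" and d: "d > 0" and disc: "b\<^sup>2 - 4 * a * c = - int d"
  defines "S \<equiv> {(x, y). upper_half x y \<and> form_val (a, b, c) x y \<le> int N}"
  shows "finite S" and "real (card S) \<le> (2 * sqrt (real_of_int a * N / d) + 1) * (2 * sqrt (N / a) + 1)"
proof -
  define R where "R = 2 * sqrt (real_of_int a * N)"
  define l r where "l = (\<lambda>y::int. (- (b * y) - R) / (2 * a))" and "r = (\<lambda>y::int. (- (b * y) + R) / (2 * a))"
  define X where "X y = {x::int. l y \<le> real_of_int x \<and> real_of_int x \<le> r y}" for y :: int
  define Ys where "Ys = {y::int. 0 \<le> real_of_int y \<and> real_of_int y \<le> 2 * sqrt (real_of_int a * N / d)}"
  have a0: "real_of_int a > 0" using a by simp
  have d0: "real d > 0" using d by simp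
  have R0: "R \<ge> 0" using a0 by (simp add: R_def)
  have R2: "R\<^sup>2 = 4 * (real_of_int a * N)" using a0 by (simp add: R_def power_mult_distrib)
  have rl: "r y - l y = 2 * sqrt (N / a)" for y
  proof -
    have "r y - l y = R / a" using a0 by (simp add: r_def l_def field_simps)
    also have "R / a = 2 * (sqrt (real_of_int a * N) / sqrt (real_of_int a * a))"
      using a0 by (simp add: R_def)
    also have "\<dots> = 2 * sqrt (real_of_int a * N / (real_of_int a * a))"
      by (simp only: real_sqrt_divide)
    also have "real_of_int a * N / (real_of_int a * a) = N / a" using a0 by simp
    finally show ?thesis .
  qed
  have sub: "S \<subseteq> (\<lambda>(y, x). (x, y)) ` (Sigma Ys X)"
  proof
    fix z assume z: "z \<in> S"
    obtain x y where zz: "z = (x, y)" by (cases z)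
    have y0: "y \<ge> 0" and v: "a * x\<^sup>2 + b * x * y + c * y\<^sup>2 \<le> int N"
      using z unfolding zz S_def upper_half_def form_val_def by auto
    have id: "4 * a * (a * x\<^sup>2 + b * x * y + c * y\<^sup>2) = (2 * a * x + b * y)\<^sup>2 + int d * y\<^sup>2"
    proof -
      have "int d = 4 * a * c - b\<^sup>2" using disc by simp
      then show ?thesis by (simp only:) (simp add: power2_eq_square algebra_simps)
    qed
    have "(2 * a * x + b * y)\<^sup>2 + int d * y\<^sup>2 \<le> 4 * a * int N"
      unfolding id[symmetric] using v a by (intro mult_left_mono) auto
    then have "real_of_int ((2 * a * x + b * y)\<^sup>2 + int d * y\<^sup>2) \<le> real_of_int (4 * a * int N)"
      by (simp only: of_int_le_iff)
    then have le: "(real_of_int (2 * a * x + b * y))\<^sup>2 + real d * (real_of_int y)\<^sup>2 \<le> 4 * (real_of_int a * N)"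
      by simp
    have dy: "0 \<le> real d * (real_of_int y)\<^sup>2" by simp
    have "(real_of_int (2 * a * x + b * y))\<^sup>2 \<le> R\<^sup>2"
      unfolding R2 using le dy by linarith
    then have "\<bar>real_of_int (2 * a * x + b * y)\<bar> \<le> R"
      by (metis abs_le_square_iff abs_of_nonneg R0)
    then have "x \<in> X y"
      using a0 unfolding X_def l_def r_def by (auto simp: field_simps abs_le_iff)
    moreover have "y \<in> Ys"
    proof -
      have "real d * (real_of_int y)\<^sup>2 \<le> 4 * (real_of_int a * N)"
        using le zero_le_power2[of "real_of_int (2 * a * x + b * y)"] by linarith
      then have "(real_of_int y)\<^sup>2 \<le> 4 * (real_of_int a * N / d)" using d0 by (simp add: field_simps)
      also have "\<dots> = (2 * sqrt (real_of_int a * N / d))\<^sup>2"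
        using a0 d0 by (simp add: power_mult_distrib)
      finally have "real_of_int y \<le> 2 * sqrt (real_of_int a * N / d)"
        by (rule power2_le_imp_le) (use a0 d0 in simp)
      then show ?thesis using y0 by (simp add: Ys_def)
    qed
    ultimately show "z \<in> (\<lambda>(y, x). (x, y)) ` (Sigma Ys X)" unfolding zz by force
  qed
  have finY: "finite Ys" unfolding Ys_def by (rule finite_real_interval_int)
  have finX: "finite (X y)" for y unfolding X_def by (rule finite_real_interval_int)
  have fin: "finite (Sigma Ys X)" using finY finX by blast
  then show "finite S" using sub finite_subset by blast
  have "card S \<le> card (Sigma Ys X)"
    using sub fin by (meson card_image_le card_mono finite_imageI le_trans)
  also have "\<dots> = (\<Sum>y\<in>Ys. card (X y))" using finY finX by simp
  finally have "real (card S) \<le> (\<Sum>y\<in>Ys. real (card (X y)))"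
    by (metis of_nat_le_iff of_nat_sum)
  also have "\<dots> \<le> (\<Sum>y\<in>Ys. 2 * sqrt (N / a) + 1)"
  proof (rule sum_mono)
    fix y
    have "0 \<le> sqrt (N / a)" using a0 by simp
    then have "l y \<le> r y + 1" using rl[of y] by linarith
    then show "real (card (X y)) \<le> 2 * sqrt (N / a) + 1"
      unfolding X_def using card_real_interval_int[of "l y" "r y"] rl[of y] by simp
  qed
  also have "\<dots> = real (card Ys) * (2 * sqrt (N / a) + 1)" by simp
  also have "\<dots> \<le> (2 * sqrt (real_of_int a * N / d) + 1) * (2 * sqrt (N / a) + 1)"
  proof (rule mult_right_mono)
    have "sqrt (real_of_int a * N / d) \<ge> 0" using a0 by simp
    then show "real (card Ys) \<le> 2 * sqrt (real_of_int a * N / d) + 1"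
      unfolding Ys_def using card_real_interval_int[of 0 "2 * sqrt (real_of_int a * N / d)"] by simp
    show "0 \<le> 2 * sqrt (N / a) + 1" using a0 by (simp add: add_nonneg_nonneg)
  qed
  finally show "real (card S) \<le> (2 * sqrt (real_of_int a * N / d) + 1) * (2 * sqrt (N / a) + 1)" .
qed

lemma card_form_reps_le:
  fixes a b c :: int
  assumes a: "a > 0" and d: "d > 0" and disc: "b\<^sup>2 - 4 * a * c = - int d" and N: "N \<ge> (1::nat)"
  shows "real (card {(x, y). upper_half x y \<and> form_val (a, b, c) x y \<le> int N})
    \<le> 4 * real N / sqrt d + (2 * sqrt (a / d) + 2 * sqrt (1 / a) + 1) * sqrt N"
proof -
  have a0: "real_of_int a > 0" using a by simp
  have d0: "real d > 0" using d by simp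
  have s1: "sqrt (real_of_int a * N / d) = sqrt (a / d) * sqrt N" by (simp add: real_sqrt_mult real_sqrt_divide)
  have s2: "sqrt (N / a) = sqrt (1 / a) * sqrt N" by (simp add: real_sqrt_mult real_sqrt_divide)
  have s3: "sqrt (a / d) * sqrt N * (sqrt (1 / a) * sqrt N) = N / sqrt d"
    using a0 by (simp add: real_sqrt_divide)
  have N1: "1 \<le> sqrt N" using N by simp
  have "real (card {(x, y). upper_half x y \<and> form_val (a, b, c) x y \<le> int N})
     \<le> (2 * (sqrt (a / d) * sqrt N) + 1) * (2 * (sqrt (1 / a) * sqrt N) + 1)"
    using card_form_reps(2)[OF a d disc, of N] unfolding s1 s2 .
  also have "\<dots> = 4 * (sqrt (a / d) * sqrt N * (sqrt (1 / a) * sqrt N))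
      + 2 * sqrt (a / d) * sqrt N + 2 * sqrt (1 / a) * sqrt N + 1"
    by (simp add: algebra_simps)
  also have "\<dots> \<le> 4 * real N / sqrt d + (2 * sqrt (a / d) + 2 * sqrt (1 / a) + 1) * sqrt N"
    unfolding s3 using N1 by (simp add: algebra_simps)
  finally show ?thesis .
qed

lemma card_half_reps:
  assumes d: "d > 0" and fin: "finite (reduced_forms (- int d))"
  obtains K where "\<And>N. N \<ge> 1 \<Longrightarrow> finite (half_reps (- int d) N) \<and>
    real (card (half_reps (- int d) N)) \<le> 4 * real (class_number (- int d)) * real N / sqrt d + K * sqrt N"
proof -
  let ?F = "reduced_forms (- int d)"
  define K where "K = (\<Sum>(a, b, c)\<in>?F. 2 * sqrt (a / d) + 2 * sqrt (1 / a) + 1)"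
  have "finite (half_reps (- int d) N) \<and>
    real (card (half_reps (- int d) N)) \<le> 4 * real (class_number (- int d)) * real N / sqrt d + K * sqrt N"
    if N: "N \<ge> 1" for N
  proof -
    define S where "S f = {(x, y). upper_half x y \<and> form_val f x y \<le> int N}" for f
    have eq: "half_reps (- int d) N = Sigma ?F S"
      unfolding half_reps_def S_def by auto
    have S: "finite (S (a, b, c))"
      "real (card (S (a, b, c))) \<le> 4 * real N / sqrt d + (2 * sqrt (a / d) + 2 * sqrt (1 / a) + 1) * sqrt N"
      if "(a, b, c) \<in> ?F" for a b c
    proof -
      have "a > 0" "b\<^sup>2 - 4 * a * c = - int d" using that by (auto simp: reduced_forms_def)
      then show "finite (S (a, b, c))"
        "real (card (S (a, b, c))) \<le> 4 * real N / sqrt d + (2 * sqrt (a / d) + 2 * sqrt (1 / a) + 1) * sqrt N"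
        unfolding S_def using card_form_reps(1)[of a d b c N] card_form_reps_le[of a d b c N] d N by auto
    qed
    have finS: "finite (S f)" if "f \<in> ?F" for f using S(1) that by (cases f) auto
    have fin': "finite (half_reps (- int d) N)" unfolding eq using fin finS by blast
    have "real (card (half_reps (- int d) N)) = (\<Sum>f\<in>?F. real (card (S f)))"
      unfolding eq using fin finS by (subst card_SigmaI) auto
    also have "\<dots> \<le> (\<Sum>f\<in>?F. 4 * real N / sqrt d + (case f of (a, b, c) \<Rightarrow> 2 * sqrt (a / d) + 2 * sqrt (1 / a) + 1) * sqrt N)"
      by (rule sum_mono) (use S(2) in auto)
    also have "\<dots> = 4 * real (class_number (- int d)) * real N / sqrt d + K * sqrt N"
      unfolding sum.distrib K_def class_number_def sum_distrib_right by simp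
    finally show ?thesis using fin' by blast
  qed
  then show ?thesis by (rule that)
qed

section \<open>Divisor sums, partial summation and the limit\<close>

lemma sum_divisors_eq_sum_floor:
  fixes f :: "nat \<Rightarrow> int"
  shows "(\<Sum>n=1..N. \<Sum>k | k dvd n. f k) = (\<Sum>k<N. f (Suc k) * int (N div Suc k))"
proof (induction N)
  case (Suc N)
  have "{k. k dvd Suc N} = Suc ` {k. k < Suc N \<and> Suc k dvd Suc N}"
  proof (intro equalityI subsetI)
    fix k assume k: "k \<in> {k. k dvd Suc N}"
    then have "k > 0" "k \<le> Suc N" by (auto intro!: Nat.gr0I dest: dvd_imp_le)
    then obtain j where "k = Suc j" "j < Suc N" by (cases k) auto
    then show "k \<in> Suc ` {k. k < Suc N \<and> Suc k dvd Suc N}" using k by auto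
  qed auto
  then have "(\<Sum>k | k dvd Suc N. f k) = (\<Sum>k | k < Suc N \<and> Suc k dvd Suc N. f (Suc k))"
    by (simp add: sum.reindex)
  also have "\<dots> = (\<Sum>k<Suc N. if Suc k dvd Suc N then f (Suc k) else 0)"
    by (subst sum.inter_filter[symmetric]) (auto intro!: sum.cong)
  also have "\<dots> = (\<Sum>k<Suc N. f (Suc k) * int (Suc N div Suc k) - f (Suc k) * int (N div Suc k))"
    \<comment> \<open>Passing from \<open>N\<close> to \<open>Suc N\<close> raises the quotient by
      \<open>Suc k\<close> exactly when \<open>Suc k\<close> divides \<open>Suc N\<close>. The new
      index \<open>k = N\<close> is harmless in the second sum, where
      \<open>N div Suc N = 0\<close>.\<close>
    by (intro sum.cong) (auto simp: div_Suc dvd_eq_mod_eq_0 mod_Suc algebra_simps)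
  also have "\<dots> = (\<Sum>k<Suc N. f (Suc k) * int (Suc N div Suc k)) - (\<Sum>k<Suc N. f (Suc k) * int (N div Suc k))"
    by (rule sum_subtractf)
  finally show ?case using Suc by simp
qed simp

text \<open>Partial summation with decreasing weights, which telescope to \<open>w m\<close>. The
  factor 2 appears because sums starting at \<open>m\<close> are differences of two partial sums
  from 0.\<close>

lemma abel_summation_bound:
  fixes c w :: "nat \<Rightarrow> real"
  assumes c: "\<And>n. \<bar>\<Sum>k<n. c k\<bar> \<le> B" and w: "\<And>k. k \<ge> m \<Longrightarrow> 0 \<le> w k" "\<And>k. k \<ge> m \<Longrightarrow> w (Suc k) \<le> w k"
    and mn: "m \<le> n"
  shows "\<bar>\<Sum>k=m..<n. c k * w k\<bar> \<le> 2 * B * w m"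
proof -
  define G where "G j = (\<Sum>k=m..<j. c k)" for j
  have G: "\<bar>G j\<bar> \<le> 2 * B" if "m \<le> j" for j
  proof -
    have "(\<Sum>k<j. c k) = (\<Sum>k<m. c k) + G j"
      unfolding G_def using sum.atLeastLessThan_concat[of 0 m j c] that by (simp add: atLeast0LessThan)
    then show ?thesis using c[of j] c[of m] by linarith
  qed
  have id: "(\<Sum>k=m..<n. c k * w k) = G n * w n + (\<Sum>k=m..<n. G (Suc k) * (w k - w (Suc k)))"
    using mn
  proof (induction n rule: dec_induct)
    case base
    then show ?case by (simp add: G_def)
  next
    case (step j)
    then show ?case by (simp add: G_def algebra_simps)
  qed
  have "\<bar>\<Sum>k=m..<n. c k * w k\<bar> \<le> \<bar>G n * w n\<bar> + (\<Sum>k=m..<n. \<bar>G (Suc k) * (w k - w (Suc k))\<bar>)"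
    unfolding id using sum_abs[of "\<lambda>k. G (Suc k) * (w k - w (Suc k))" "{m..<n}"] by linarith
  also have "\<dots> \<le> 2 * B * w n + (\<Sum>k=m..<n. 2 * B * (w k - w (Suc k)))"
  proof (intro add_mono sum_mono)
    show "\<bar>G n * w n\<bar> \<le> 2 * B * w n"
      using G[OF mn] w(1)[OF mn] by (simp add: abs_mult mult_right_mono)
    fix k assume "k \<in> {m..<n}"
    then show "\<bar>G (Suc k) * (w k - w (Suc k))\<bar> \<le> 2 * B * (w k - w (Suc k))"
      using G[of "Suc k"] w(2)[of k] by (simp add: abs_mult mult_right_mono)
  qed
  also have "(\<Sum>k=m..<n. 2 * B * (w k - w (Suc k))) = 2 * B * (w m - w n)"
    using mn by (induction n rule: dec_induct) (auto simp: algebra_simps)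
  finally show ?thesis by (simp add: algebra_simps)
qed

lemma summable_over_n_if_bounded_partial_sums:
  fixes c :: "nat \<Rightarrow> real"
  assumes c: "\<And>n. \<bar>\<Sum>k<n. c k\<bar> \<le> B"
  shows "summable (\<lambda>k. c k / real (Suc k))"
  unfolding summable_Cauchy
proof (intro allI impI)
  fix e :: real assume e: "e > 0"
  have B0: "B \<ge> 0" using c[of 0] by simp
  obtain N :: nat where N: "2 * B / e < real N" using reals_Archimedean2 by blast
  have "norm (\<Sum>k=m..<n. c k / real (Suc k)) < e" if m: "m \<ge> N" for m n
  proof (cases "m \<le> n")
    case True
    have "\<bar>\<Sum>k=m..<n. c k * (1 / real (Suc k))\<bar> \<le> 2 * B * (1 / real (Suc m))"
      by (rule abel_summation_bound[OF c _ _ True]) (auto simp: field_simps)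
    also have "\<dots> < e"
    proof -
      have "2 * B < e * real N" using N e by (simp add: field_simps)
      also have "\<dots> \<le> e * real (Suc m)" using m e by (intro mult_left_mono) auto
      finally show ?thesis by (simp add: field_simps)
    qed
    finally show ?thesis by simp
  next
    case False
    then show ?thesis using e by simp
  qed
  then show "\<exists>N. \<forall>m\<ge>N. \<forall>n. norm (\<Sum>k=m..<n. c k / real (Suc k)) < e" by blast
qed

text \<open>Below the cut \<open>M\<close>, removing each floor costs at most 1; beyond it, the
  floors are decreasing weights for partial summation. After division by \<open>N\<close> the errors
  are \<open>M / N\<close> and \<open>2 * B / Suc M\<close>, which vanish when first
  \<open>N\<close> and then \<open>M\<close> tends to infinity.\<close>

lemma partial_sum_le_divisor_sum:
  fixes c :: "nat \<Rightarrow> real"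
  assumes c: "\<And>n. \<bar>\<Sum>k<n. c k\<bar> \<le> B" and c1: "\<And>k. \<bar>c k\<bar> \<le> 1" and MN: "M \<le> N"
  shows "N * (\<Sum>k<M. c k / real (Suc k)) \<le> (\<Sum>k<N. c k * real (N div Suc k)) + M + 2 * B * (N / Suc M)"
proof -
  have B0: "B \<ge> 0" using c[of 0] by simp
  have "N * (\<Sum>k<M. c k / real (Suc k)) - (\<Sum>k<M. c k * real (N div Suc k))
      = (\<Sum>k<M. c k * (N / real (Suc k) - real (N div Suc k)))"
    by (simp add: sum_distrib_left sum_subtractf[symmetric] algebra_simps)
  also have "\<dots> \<le> (\<Sum>k<M. 1)"
  proof (rule sum_mono)
    fix k
    have "real (N mod Suc k) \<le> real (Suc k)"
      using mod_less_divisor[of "Suc k" N] unfolding of_nat_le_iff by linarith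
    then have "real (N mod Suc k) / real (Suc k) \<le> 1" by simp
    then have "0 \<le> N / real (Suc k) - real (N div Suc k)" "N / real (Suc k) - real (N div Suc k) \<le> 1"
      using of_nat_of_nat_div_aux[of N "Suc k", where ?'a = real] by simp_all
    then have "\<bar>c k * (N / real (Suc k) - real (N div Suc k))\<bar> \<le> 1"
      using c1[of k] by (simp only: abs_mult) (simp add: mult_le_one)
    then show "c k * (N / real (Suc k) - real (N div Suc k)) \<le> 1" by linarith
  qed
  finally have 1: "N * (\<Sum>k<M. c k / real (Suc k)) \<le> (\<Sum>k<M. c k * real (N div Suc k)) + M" by simp
  have "\<bar>\<Sum>k=M..<N. c k * real (N div Suc k)\<bar> \<le> 2 * B * real (N div Suc M)"
    by (rule abel_summation_bound[OF c _ _ MN]) (auto intro: div_le_mono2)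
  also have "\<dots> \<le> 2 * B * (N / Suc M)"
    using B0 of_nat_div_le_of_nat[of N "Suc M", where ?'a = real] by (intro mult_left_mono) auto
  finally have 2: "- (\<Sum>k=M..<N. c k * real (N div Suc k)) \<le> 2 * B * (N / Suc M)" by linarith
  have "(\<Sum>k<N. c k * real (N div Suc k)) = (\<Sum>k<M. c k * real (N div Suc k)) + (\<Sum>k=M..<N. c k * real (N div Suc k))"
    using sum.atLeastLessThan_concat[of 0 M N "\<lambda>k. c k * real (N div Suc k)"] MN by (simp add: atLeast0LessThan)
  then show ?thesis using 1 2 by linarith
qed

lemma L1_le_class_number:
  assumes d: "d > 8" and fd: "fundamental_disc (- int d)" and fin: "finite (reduced_forms (- int d))"
  shows "L1 (- int d) \<le> 4 * real (class_number (- int d)) / sqrt d"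
proof -
  let ?D = "- int d"
  obtain f B where f: "\<And>n. n > 0 \<Longrightarrow> kronecker ?D n = f n"
    "\<And>m n. f (m * n) = f m * f n" "f 1 = 1" "f 0 = 0" "\<And>n. f n \<in> {-1, 0, 1}"
    "\<And>N. \<bar>sum f {..<N}\<bar> \<le> int B"
    using kronecker_character[OF d fd] by blast
  have D4: "?D mod 4 = 0 \<or> ?D mod 4 = 1" by (rule fundamental_disc_mod4[OF fd])
  have D0: "?D < 0" and d0: "d > 0" using d by simp_all
  have pr: "f q = kron_prime ?D q" if q: "prime q" for q
    using f(1)[of q] q prime_gt_0_nat[OF q] unfolding kronecker_def by (simp add: prime_prime_factors)
  define c where "c k = real_of_int (f (Suc k))" for k
  have cB: "\<bar>\<Sum>k<n. c k\<bar> \<le> real B" for n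
  proof -
    have "(\<Sum>k<n. f (Suc k)) = sum f {..<Suc n}"
      unfolding sum.lessThan_Suc_shift f(4) by simp
    then have "\<bar>\<Sum>k<n. f (Suc k)\<bar> \<le> int B" using f(6)[of "Suc n"] by simp
    then have "\<bar>real_of_int (\<Sum>k<n. f (Suc k))\<bar> \<le> real B" by linarith
    then show ?thesis by (simp add: c_def)
  qed
  have c1: "\<bar>c k\<bar> \<le> 1" for k using f(5)[of "Suc k"] by (auto simp: c_def)
  have L: "L1 ?D = (\<Sum>k. c k / real (Suc k))"
    unfolding L1_def c_def using f(1) by simp
  \<comment> \<open>Summability ensures that the infinite sum in \<open>L1\<close> is the limit of
    its partial sums and not an arbitrary value.\<close>
  have lim: "(\<lambda>M. \<Sum>k<M. c k / real (Suc k)) \<longlonglongrightarrow> L1 ?D"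
    unfolding L using summable_LIMSEQ[OF summable_over_n_if_bounded_partial_sums[OF cB]] .
  obtain K where K: "\<And>N. N \<ge> 1 \<Longrightarrow> finite (half_reps ?D N) \<and>
    real (card (half_reps ?D N)) \<le> 4 * real (class_number ?D) * real N / sqrt d + K * sqrt N"
    using card_half_reps[OF d0 fin] by blast
  define A where "A = 4 * real (class_number ?D) / sqrt d"
  have T: "(\<Sum>k<N. c k * real (N div Suc k)) \<le> A * real N + K * sqrt N" if N: "N \<ge> 1" for N
  proof -
    have "(\<Sum>k<N. f (Suc k) * int (N div Suc k)) = (\<Sum>n=1..N. \<Sum>k | k dvd n. f k)"
      by (rule sum_divisors_eq_sum_floor[symmetric])
    also have "\<dots> \<le> (\<Sum>n=1..N. int (card (ideal_data ?D n)))"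
      by (intro sum_mono sum_divisors_le_card_ideal_data[OF D4 f(2,3,5) pr]) auto
    also have "\<dots> \<le> int (card (half_reps ?D N))"
      using sum_ideal_data_le[OF fd D0, of N] K[OF N] by (simp flip: of_nat_sum)
    finally have "real_of_int (\<Sum>k<N. f (Suc k) * int (N div Suc k)) \<le> real (card (half_reps ?D N))"
      by linarith
    also have "\<dots> \<le> A * real N + K * sqrt N" using K[OF N] by (simp add: A_def)
    finally show ?thesis by (simp add: c_def)
  qed
  \<comment> \<open>The limit in \<open>N\<close> with \<open>M\<close> fixed: it removes the
    boundary term \<open>K * sqrt N\<close> of the lattice count and the rounding error
    \<open>M\<close>.\<close>
  have sM: "(\<Sum>k<M. c k / real (Suc k)) \<le> A + 2 * real B / real (Suc M)" for M
  proof -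
    let ?s = "\<Sum>k<M. c k / real (Suc k)"
    have "(\<lambda>N. A + K / sqrt (real N) + M / real N + 2 * real B / real (Suc M)) \<longlonglongrightarrow> A + 0 + 0 + 2 * real B / real (Suc M)"
    proof (intro tendsto_add tendsto_const)
      show "(\<lambda>N. M / real N) \<longlonglongrightarrow> 0" by (rule lim_const_over_n)
      have "filterlim (\<lambda>N. sqrt (real N)) at_top sequentially"
        by (intro filterlim_compose[OF sqrt_at_top] filterlim_real_sequentially)
      then show "(\<lambda>N. K / sqrt (real N)) \<longlonglongrightarrow> 0"
        by (intro tendsto_divide_0[OF tendsto_const] filterlim_at_top_imp_at_infinity)
    qed
    moreover have "\<forall>N\<ge>max 1 M. ?s \<le> A + K / sqrt (real N) + M / real N + 2 * real B / real (Suc M)"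
    proof (intro allI impI)
      fix N assume N: "max 1 M \<le> N"
      then have N0: "real N > 0" by simp
      have "N * ?s \<le> A * real N + K * sqrt N + M + 2 * real B * (N / Suc M)"
        using partial_sum_le_divisor_sum[OF cB c1, of M N] T[of N] N by simp
      then have "?s \<le> (A * real N + K * sqrt N + M + 2 * real B * (N / Suc M)) / N"
        unfolding pos_le_divide_eq[OF N0] by (simp only: mult.commute)
      also have "\<dots> = A + K * (sqrt N / N) + M / N + 2 * real B / real (Suc M)"
        using N0 by (simp add: add_divide_distrib)
      also have "sqrt N / N = 1 / sqrt N"
        using real_sqrt_mult_self[of "real N"] N0 by (simp add: field_simps del: real_sqrt_mult_self)
      finally show "?s \<le> A + K / sqrt (real N) + M / real N + 2 * real B / real (Suc M)" by simp
    qed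
    ultimately show ?thesis using LIMSEQ_le_const by fastforce
  qed
  have "(\<lambda>M. A + 2 * real B / real (Suc M)) \<longlonglongrightarrow> A + 0"
    by (intro tendsto_add tendsto_const LIMSEQ_Suc[OF lim_const_over_n])
  with lim have "L1 ?D \<le> A + 0" by (rule LIMSEQ_le) (use sM in blast)
  then show ?thesis by (simp add: A_def)
qed

section \<open>The first 66 primes\<close>

text \<open>A composite number below 361 = 19^2 has its least prime factor below 19, hence in the
  given list.\<close>

lemma prime_iff_no_small_factor:
  assumes "n < (361::nat)"
  shows "prime n \<longleftrightarrow> n > 1 \<and> (\<forall>q\<in>{2, 3, 5, 7, 11, 13, 17}. q dvd n \<longrightarrow> n = q)"
proof
  assume p: "prime n"
  have small: "prime q" if "q \<in> {2, 3, 5, 7, 11, 13, 17}" for q :: nat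
    using that by auto
  have "n = q" if "q \<in> {2, 3, 5, 7, 11, 13, 17}" "q dvd n" for q
    using that primes_dvd_imp_eq[OF _ p] small by blast
  then show "n > 1 \<and> (\<forall>q\<in>{2, 3, 5, 7, 11, 13, 17}. q dvd n \<longrightarrow> n = q)"
    using prime_gt_1_nat[OF p] by blast
next
  assume n: "n > 1 \<and> (\<forall>q\<in>{2, 3, 5, 7, 11, 13, 17}. q dvd n \<longrightarrow> n = q)"
  show "prime n"
  proof (rule ccontr)
    assume np: "\<not> prime n"
    define q where "q = (LEAST q. prime q \<and> q dvd n)"
    have "\<exists>q. prime q \<and> q dvd n" using n prime_factor_nat[of n] by auto
    then have q: "prime q" "q dvd n" unfolding q_def by (metis (mono_tags, lifting) LeastI_ex)+
    obtain r where r: "n = q * r" using q by auto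
    have "r \<noteq> 1" using np q r by auto
    then obtain s where s: "prime s" "s dvd r" using prime_factor_nat by blast
    then have "q \<le> s" unfolding q_def r[symmetric] using r by (intro Least_le) (auto simp: dvd_mult)
    moreover have "s \<le> r" using s n r by (intro dvd_imp_le) (auto intro!: Nat.gr0I)
    ultimately have "q * q \<le> n" unfolding r by simp
    have q19: "q < 19"
    proof (rule ccontr)
      assume "\<not> q < 19"
      then have "19 * 19 \<le> q * q" by (intro mult_le_mono) auto
      then show False using \<open>q * q \<le> n\<close> assms by simp
    qed
    \<comment> \<open>Excluding proper multiples of 2 and 3 from 2 to 18 leaves exactly the seven
      listed primes.\<close>
    have q23: "even q \<longrightarrow> q = 2" "3 dvd q \<longrightarrow> q = 3"
      using primes_dvd_imp_eq[OF two_is_prime_nat q(1)] primes_dvd_imp_eq[of 3 q] q(1) by auto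
    have "q \<in> set [2..<19]"
      using q19 prime_ge_2_nat[OF q(1)] by (simp only: set_upt atLeastLessThan_iff)
    then have "q \<in> {2, 3, 5, 7, 11, 13, 17}"
      using q23 by (simp del: set_upt) (elim disjE; simp)
    then have "n = q" using n q by blast
    then show False using q np by simp
  qed
qed

definition primes66 :: "nat list" where
  "primes66 =
    [2, 3, 5, 7, 11, 13, 17, 19, 23, 29, 31, 37, 41, 43, 47, 53, 59, 61, 67, 71, 73, 79, 83,
    89, 97, 101, 103, 107, 109, 113, 127, 131, 137, 139, 149, 151, 157, 163, 167, 173, 179,
    181, 191, 193, 197, 199, 211, 223, 227, 229, 233, 239, 241, 251, 257, 263, 269, 271, 277,
    281, 283, 293, 307, 311, 313, 317]"

lemma primes66_filter:
  "primes66 = filter (\<lambda>n. \<forall>q\<in>{2, 3, 5, 7, 11, 13, 17}. q dvd n \<longrightarrow> n = q) [2..<318]"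
  unfolding primes66_def by simp

lemma set_primes66: "set primes66 = {p. prime p \<and> p \<le> 317}"
proof -
  have "p \<in> set primes66 \<longleftrightarrow> prime p \<and> p \<le> 317" for p
  proof (cases "p < 318")
    case True
    then have "prime p \<longleftrightarrow> p > 1 \<and> (\<forall>q\<in>{2, 3, 5, 7, 11, 13, 17}. q dvd p \<longrightarrow> p = q)"
      by (intro prime_iff_no_small_factor) simp
    moreover have "p > 1 \<longleftrightarrow> 2 \<le> p" "p \<le> 317" using True by auto
    ultimately show ?thesis using True
      unfolding primes66_filter set_filter set_upt mem_Collect_eq atLeastLessThan_iff by blast
  next
    case False
    then have "\<not> p \<le> 317" by simp
    then show ?thesis using False
      unfolding primes66_filter set_filter set_upt mem_Collect_eq atLeastLessThan_iff by blast
  qed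
  then show ?thesis by blast
qed

lemma distinct_primes66: "distinct primes66"
  unfolding primes66_filter by (intro distinct_filter distinct_upt)

lemma length_primes66: "length primes66 = 66"
  unfolding primes66_def by simp

lemma card_primes66: "card (set primes66) = 66"
  using distinct_card[OF distinct_primes66] length_primes66 by simp

lemma primorial_first_66: "primorial_first 66 = \<Prod>(set primes66)"
proof -
  have "{p::nat. prime p \<and> card {q. prime q \<and> q < p} < 66} = {p. prime p \<and> p \<le> 317}" (is "?A = ?B")
  proof (intro equalityI subsetI)
    fix p assume p: "p \<in> ?A"
    have "p \<le> 317"
    proof (rule ccontr)
      assume "\<not> p \<le> 317"
      then have "?B \<subseteq> {q. prime q \<and> q < p}" by auto
      moreover have "finite {q. prime q \<and> q < p}" by simp
      ultimately have "card ?B \<le> card {q. prime q \<and> q < p}" by (rule card_mono[rotated])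
      then show False using p card_primes66 unfolding set_primes66 by simp
    qed
    then show "p \<in> ?B" using p by simp
  next
    fix p assume p: "p \<in> ?B"
    then have "{q. prime q \<and> q < p} \<subset> ?B" by auto
    moreover have "finite ?B" by simp
    ultimately have "card {q. prime q \<and> q < p} < card ?B" by (rule psubset_card_mono[rotated])
    then show "p \<in> ?A" using p card_primes66 unfolding set_primes66 by simp
  qed
  then show ?thesis unfolding primorial_first_def set_primes66 by simp
qed

section \<open>Size of the primorial and the final numerical inequality\<close>

lemma primorial_first_66_eq:
  "primorial_first 66 = 19361386640700823163471425054312320082662897612571563761906962414215012369856637179096947335243680669607531475629148240284399976570"
proof -
  have "primorial_first 66 = prod_list primes66"
    unfolding primorial_first_66 using prod.distinct_set_conv_list[OF distinct_primes66, of "\<lambda>x. x"] by simp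
  then show ?thesis unfolding primes66_def by simp
qed

text \<open>With \<open>M\<close> the primorial, the second bound says \<open>M < 2.7 ^ 305\<close>,
  hence \<open>ln M < 305\<close> since 2.7 < e. The first is the square of
  \<open>4 * 2 ^ 65 * 305 ^ 18 < sqrt M\<close>, the desired inequality at \<open>g = 66\<close>
  with 305 for the logarithm.\<close>

lemma primorial_first_66_bounds:
  "2 ^ 134 * 305 ^ 36 < primorial_first 66" "primorial_first 66 * 10 ^ 305 < 27 ^ 305"
  unfolding primorial_first_66_eq by simp_all

text \<open>Dividing every prime by 317, the last of the first 66 primes, makes the product over the first 66
  primes minimal among the products over all finite sets of primes, whatever their cardinality.\<close>

lemma primorial_first_66_le:
  assumes S: "finite S" "\<And>p. p \<in> S \<Longrightarrow> prime p"
  shows "primorial_first 66 * 317 ^ card S \<le> \<Prod>S * 317 ^ 66"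
proof -
  let ?Q = "set primes66"
  have Q: "p \<le> 317" if "p \<in> ?Q" for p using that unfolding set_primes66 by simp
  have S317: "317 \<le> p" if "p \<in> S - ?Q" for p using that S(2)[of p] unfolding set_primes66 by auto
  have "\<Prod>(?Q - S) \<le> (\<Prod>p\<in>?Q - S. 317)" by (rule prod_mono) (use Q in auto)
  then have 1: "\<Prod>(?Q - S) \<le> 317 ^ card (?Q - S)" by simp
  have "(\<Prod>p\<in>S - ?Q. 317) \<le> \<Prod>(S - ?Q)" by (rule prod_mono) (use S317 in auto)
  then have 2: "317 ^ card (S - ?Q) \<le> \<Prod>(S - ?Q)" by simp
  have pQ: "\<Prod>?Q = \<Prod>(?Q - S) * \<Prod>(?Q \<inter> S)"
    by (subst prod.union_disjoint[symmetric]) (auto simp: Un_Diff_Int)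
  have pS: "\<Prod>S = \<Prod>(S - ?Q) * \<Prod>(?Q \<inter> S)"
    using S(1) by (subst prod.union_disjoint[symmetric]) (auto simp: Un_Diff_Int Int_commute)
  have cQ: "66 = card (?Q - S) + card (?Q \<inter> S)"
    using card_primes66 card_Diff_subset_Int[of ?Q S] card_mono[of ?Q "?Q \<inter> S"] by simp
  have cS: "card S = card (S - ?Q) + card (?Q \<inter> S)"
    using S(1) card_Diff_subset_Int[of S ?Q] card_mono[of S "?Q \<inter> S"] by (simp add: Int_commute)
  have "\<Prod>(?Q - S) * 317 ^ card (S - ?Q) \<le> 317 ^ card (?Q - S) * \<Prod>(S - ?Q)"
    by (rule mult_le_mono[OF 1 2])
  then have "(\<Prod>(?Q - S) * 317 ^ card (S - ?Q)) * (\<Prod>(?Q \<inter> S) * 317 ^ card (?Q \<inter> S))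
      \<le> (317 ^ card (?Q - S) * \<Prod>(S - ?Q)) * (\<Prod>(?Q \<inter> S) * 317 ^ card (?Q \<inter> S))"
    by (rule mult_le_mono1)
  moreover have "\<Prod>?Q * 317 ^ card S = (\<Prod>(?Q - S) * 317 ^ card (S - ?Q)) * (\<Prod>(?Q \<inter> S) * 317 ^ card (?Q \<inter> S))"
    unfolding pQ cS power_add by (simp only: mult_ac)
  moreover have "\<Prod>S * 317 ^ 66 = (317 ^ card (?Q - S) * \<Prod>(S - ?Q)) * (\<Prod>(?Q \<inter> S) * 317 ^ card (?Q \<inter> S))"
    unfolding pS by (subst cQ) (simp only: power_add mult_ac)
  ultimately show ?thesis unfolding primorial_first_66 by simp
qed

text \<open>The quadratic Taylor polynomial at 1 gives only 5/2; taken at 1/8 and raised to the 8th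
  power it exceeds 2.7.\<close>

lemma exp_1_ge_27_10: "27 / 10 \<le> exp (1::real)"
proof -
  have "(1 + 1 / 8 + (1 / 8)\<^sup>2 / 2) ^ 8 \<le> exp (1 / 8 :: real) ^ 8"
    by (intro power_mono exp_lower_Taylor_quadratic) auto
  also have "\<dots> = exp 1" by (simp flip: exp_of_nat_mult)
  finally show ?thesis by (rule order_trans[rotated]) (simp add: field_simps)
qed

text \<open>With \<open>d = M * exp u\<close>, both \<open>2 ^ g\<close> and \<open>ln d ^ 18\<close> gain at most a factor \<open>exp (u / 8)\<close> over their
  values at \<open>M\<close>; the first because \<open>317 > 2 ^ 8\<close>, the second because \<open>18 / 305 < 1 / 8\<close>, where
  305 is an upper bound for \<open>ln M\<close>.\<close>

lemma sqrt_beats_two_power_log: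
  assumes M: "2 ^ 134 * 305 ^ 36 < M" "M * 10 ^ 305 < 27 ^ 305"
    and d: "M < d" and g: "M * 317 ^ g \<le> d * 317 ^ 66"
  shows "4 * 2 ^ (g - 1) * ln (real d) ^ 18 < sqrt (real d)"
proof -
  define P where "P = real M"
  have P1: "2 ^ 134 * 305 ^ 36 < P" unfolding P_def
    using of_nat_less_iff[where ?'a = real, THEN iffD2, OF M(1)]
    by (simp only: of_nat_mult of_nat_numeral of_nat_power)
  have P2: "P \<le> exp 305"
  proof -
    have "P * 10 ^ 305 < 27 ^ 305" unfolding P_def
      using of_nat_less_iff[where ?'a = real, THEN iffD2, OF M(2)]
      by (simp only: of_nat_mult of_nat_numeral of_nat_power)
    then have "P < 27 ^ 305 / 10 ^ 305" by (subst pos_less_divide_eq) (rule zero_less_power, simp)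
    then have "P \<le> (27 / 10) ^ 305" unfolding power_divide by (rule less_imp_le)
    also have "\<dots> \<le> exp 1 ^ 305" by (intro power_mono exp_1_ge_27_10) simp
    also have "\<dots> = exp (real 305 * 1)" by (rule exp_of_nat_mult[symmetric])
    also have "\<dots> = exp 305" by simp
    finally show ?thesis .
  qed
  have P0: "P > 0" by (rule less_trans[OF _ P1]) simp
  define u where "u = ln (real d / P)"
  have dP: "real d > P" using d by (simp add: P_def)
  have u0: "u > 0" using dP P0 by (simp add: u_def)
  have dexp: "real d = P * exp u" using dP P0 by (simp add: u_def)
  have lnP: "ln P \<le> 305" using ln_le_cancel_iff[OF P0, of "exp 305"] P2 by simp
  have "ln (real d) = ln P + u" unfolding dexp using P0 by (simp add: ln_mult)
  also have "\<dots> \<le> 305 * (1 + u / 305)" using lnP by simp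
  also have "\<dots> \<le> 305 * exp (u / 305)" by (intro mult_left_mono exp_ge_add_one_self) simp
  finally have lnd: "ln (real d) \<le> 305 * exp (u / 305)" .
  have d1: "real d \<ge> 1" using dP P0 P_def by simp
  have "ln (real d) ^ 18 \<le> (305 * exp (u / 305)) ^ 18"
    using lnd d1 by (intro power_mono) auto
  also have "\<dots> = 305 ^ 18 * exp (real 18 * (u / 305))"
    unfolding power_mult_distrib exp_of_nat_mult ..
  also have "\<dots> \<le> 305 ^ 18 * exp (u / 8)" using u0 by simp
  finally have A: "ln (real d) ^ 18 \<le> 305 ^ 18 * exp (u / 8)" .
  have gu: "(real g - 66) * ln 317 \<le> u"
  proof -
    have "real (M * 317 ^ g) \<le> real (d * 317 ^ 66)" by (rule of_nat_mono[OF g])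
    then have "P * 317 ^ g \<le> P * (exp u * 317 ^ 66)"
      by (simp only: of_nat_mult of_nat_power of_nat_numeral P_def[symmetric] dexp mult.assoc)
    then have "317 ^ g \<le> exp u * 317 ^ 66" using P0 by (rule mult_left_le_imp_le)
    then have "ln (317 ^ g) \<le> ln (exp u * (317::real) ^ 66)"
      by (rule ln_le_cancel_iff[THEN iffD2, rotated 2])
        (intro mult_pos_pos exp_gt_zero zero_less_power zero_less_numeral)+
    also have "\<dots> = ln (exp u) + ln (317 ^ 66)"
      by (rule ln_mult_pos) (intro exp_gt_zero zero_less_power zero_less_numeral)+
    also have "\<dots> = u + real 66 * ln 317" by (simp only: ln_exp ln_realpow)
    finally show ?thesis by (simp add: ln_realpow algebra_simps)
  qed
  \<comment> \<open>Replacing \<open>ln 317\<close> by the smaller \<open>8 * ln 2\<close> is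
    legitimate only for a nonnegative factor; for \<open>g < 66\<close> the left side is at most 0
    and \<open>u > 0\<close> suffices.\<close>
  have "(real g - 66) * (8 * ln 2) \<le> u"
  proof (cases "g \<ge> 66")
    case True
    have "8 * ln 2 = ln (2 ^ 8 :: real)" by (subst ln_realpow) simp_all
    also have "\<dots> \<le> ln 317" by simp
    finally have "(real g - 66) * (8 * ln 2) \<le> (real g - 66) * ln 317"
      using True by (intro mult_left_mono) auto
    then show ?thesis using gu by linarith
  next
    case False
    then have "(real g - 66) * (8 * ln 2) \<le> 0" by (intro mult_nonpos_nonneg) auto
    then show ?thesis using u0 by linarith
  qed
  then have "real g * ln 2 \<le> 66 * ln 2 + u / 8" by (simp add: algebra_simps)
  then have "exp (real g * ln 2) \<le> exp (real 66 * ln 2 + u / 8)" by simp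
  then have "exp (ln 2) ^ g \<le> exp (ln 2) ^ 66 * exp (u / 8)"
    by (simp only: exp_add exp_of_nat_mult)
  then have g2: "2 ^ g \<le> 2 ^ 66 * exp (u / 8)" by simp
  \<comment> \<open>For \<open>g = 0\<close> truncated subtraction gives \<open>g - 1 = 0\<close>,
    so the left side is 2 rather than \<open>2 ^ g\<close>; the bound absorbs this.\<close>
  have B: "2 * 2 ^ (g - 1) \<le> 2 ^ 66 * exp (u / 8)"
  proof (cases g)
    case 0
    have "2 * 2 ^ (g - 1) \<le> 2 ^ 66 * (1::real)" using 0 by simp
    also have "\<dots> \<le> 2 ^ 66 * exp (u / 8)" using u0 by (intro mult_left_mono) auto
    finally show ?thesis .
  next
    case (Suc g')
    then show ?thesis using g2 by simp
  qed
  have "4 * 2 ^ (g - 1) * ln (real d) ^ 18 \<le> (2 * (2 ^ 66 * exp (u / 8))) * (305 ^ 18 * exp (u / 8))"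
  proof (rule mult_mono[OF _ A])
    show "4 * 2 ^ (g - 1) \<le> 2 * (2 ^ 66 * exp (u / 8))" using B by linarith
  qed (use d1 in auto)
  also have "\<dots> = 2 ^ 67 * 305 ^ 18 * (exp (u / 8) * exp (u / 8))" by simp
  also have "exp (u / 8) * exp (u / 8) = exp (u / 4)" by (simp add: exp_add[symmetric])
  \<comment> \<open>\<open>sqrt d\<close> grows like \<open>exp (u / 2)\<close>, the other side only
    like \<open>exp (u / 4)\<close>, so the comparison reduces to \<open>u = 0\<close>, which is the
    first numerical bound on \<open>M\<close>.\<close>
  also have "2 ^ 67 * 305 ^ 18 * exp (u / 4) \<le> 2 ^ 67 * 305 ^ 18 * exp (u / 2)"
    using u0 by simp
  also have "\<dots> < sqrt P * exp (u / 2)"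
  proof (intro mult_strict_right_mono real_less_rsqrt)
    show "(2 ^ 67 * 305 ^ 18)\<^sup>2 < P" using P1 by (simp only: power_mult_distrib power_mult[symmetric]) simp
  qed simp
  also have "\<dots> = sqrt (real d)"
  proof -
    have "exp (u / 2) = sqrt (exp u)"
      by (rule real_sqrt_unique[symmetric]) (simp_all add: power2_eq_square flip: exp_add)
    then show ?thesis unfolding dexp by (simp add: real_sqrt_mult)
  qed
  finally show ?thesis .
qed

lemma prod_prime_factors_le: "n > 0 \<Longrightarrow> \<Prod>(prime_factors n) \<le> (n :: nat)"
proof -
  assume n: "n > 0"
  have "\<Prod>(prime_factors n) \<le> (\<Prod>p\<in>prime_factors n. p ^ multiplicity p n)"
  proof (rule prod_mono)
    fix p assume p: "p \<in> prime_factors n"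
    then have "multiplicity p n > 0" "p > 0"
      by (auto simp: prime_factors_multiplicity prime_gt_0_nat)
    then show "0 \<le> p \<and> p \<le> p ^ multiplicity p n" using self_le_power[of p] by auto
  qed
  then show ?thesis using prime_factorization_nat[of n] n by simp
qed

theorem theorem3p2:
  fixes d :: nat
  assumes "d > 0"
    and "fundamental_disc (- int d)"
    and "L1 (- int d) \<ge> (ln (real d)) powr (-18)"
    and "one_class_per_genus d"
  shows "d \<le> primorial_first 66"
proof (rule ccontr)
  assume "\<not> d \<le> primorial_first 66"
  then have dP: "primorial_first 66 < d" by simp
  then have d8: "d > 8" unfolding primorial_first_66_eq by simp
  define g where "g = card (prime_factors d)"
  have h: "class_number (- int d) = 2 ^ (g - 1)"
    using assms(4) by (simp add: one_class_per_genus_def g_def)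
  \<comment> \<open>An infinite set has \<open>card\<close> 0, so a class number that is a power of
    2 already yields the finiteness of the set of reduced forms.\<close>
  then have "card (reduced_forms (- int d)) > 0" by (simp add: class_number_def)
  then have fin: "finite (reduced_forms (- int d))" by (rule card_ge_0_finite)
  have "primorial_first 66 * 317 ^ g \<le> \<Prod>(prime_factors d) * 317 ^ 66"
    unfolding g_def by (rule primorial_first_66_le) auto
  also have "\<dots> \<le> d * 317 ^ 66" by (intro mult_le_mono1 prod_prime_factors_le assms(1))
  finally have less: "4 * 2 ^ (g - 1) * ln (real d) ^ 18 < sqrt (real d)"
    by (rule sqrt_beats_two_power_log[OF primorial_first_66_bounds dP])
  have ln0: "ln (real d) > 0" using d8 by simp
  have "1 / ln (real d) ^ 18 = ln (real d) powr (- 18)"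
    using ln0 by (simp add: powr_minus_divide)
  also have "\<dots> \<le> 4 * real (class_number (- int d)) / sqrt d"
    using L1_le_class_number[OF d8 assms(2) fin] assms(3) by linarith
  finally have "1 / ln (real d) ^ 18 \<le> 4 * 2 ^ (g - 1) / sqrt d" by (simp add: h)
  then have "sqrt d \<le> 4 * 2 ^ (g - 1) * ln (real d) ^ 18"
    using ln0 d8 by (simp add: field_simps)
  then show False using less by simp
qed

end
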